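(* Let $p_1,p_2,p_3$ be positive integers with $\gcd(p_1,p_2,p_3)=1$ and let $n=p_1+p_2+p_3$. Then the genus of the Cayley graph $G(p_1,p_2,p_3)$ is always $0$ or $1$. In particular, the genus of $G(p_1,p_2,p_3)$ is $0$ if and only if the triangle $T(p_1,p_2,p_3)$ is isosceles and $n$ is even.
   Context: For positive integers $p_1,p_2,p_3$ with $\gcd(p_1,p_2,p_3)=1$ and $n=p_1+p_2+p_3$, $T(p_1,p_2,p_3)$ denotes a Euclidean triangle with internal angles $\alpha_i=\frac{p_i\pi}{n}$, $i=1,2,3$. Let $a,b,c$ be the linear reflections of the plane $\mathbb{R}^2$ across the lines through the origin parallel to the sides of the triangle opposite $\alpha_1,\alpha_2,\alpha_3$, respectively. The group generated by $a,b,c$ under composition is the dihedral group $D_n$ of order $2n$ (consisting of $n$ rotations about the origin and $n$ reflections). The graph $G(p_1,p_2,p_3)$ is the Cayley graph $Cay(\{a,b,c\},D_n)$, viewed as an undirected graph: its vertices are the elements of $D_n$, and $\sigma,\tau\in D_n$ are joined by a single undirected edge if and only if $\tau\in\{\sigma a,\sigma b,\sigma c\}$. The genus of a graph is the smallest non-negative integer $g$ such that the graph can be drawn without edge crossings on a closed orientable surface of genus $g$. An isosceles triangle is one with at least two equal angles (equilateral triangles are included). *)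

theory Defs
  imports "HOL-Analysis.Analysis" "HOL-Algebra.Generated_Groups" "HOL-Algebra.Bij"
begin

section \<open>Triangles and reflections\<close>

definition angle_at :: "real^2 \<Rightarrow> real^2 \<Rightarrow> real^2 \<Rightarrow> real" where
  "angle_at P Q R = arccos (((Q - P) \<bullet> (R - P)) / (norm (Q - P) * norm (R - P)))"

definition triangle_with_angles ::
    "real \<Rightarrow> real \<Rightarrow> real \<Rightarrow> real^2 \<Rightarrow> real^2 \<Rightarrow> real^2 \<Rightarrow> bool" where
  "triangle_with_angles \<alpha>\<^sub>1 \<alpha>\<^sub>2 \<alpha>\<^sub>3 A B C \<longleftrightarrow>
     \<not> collinear {A, B, C} \<and>
     angle_at A B C = \<alpha>\<^sub>1 \<and> angle_at B C A = \<alpha>\<^sub>2 \<and> angle_at C A B = \<alpha>\<^sub>3"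

definition isosceles :: "real^2 \<Rightarrow> real^2 \<Rightarrow> real^2 \<Rightarrow> bool" where
  "isosceles A B C \<longleftrightarrow>
     angle_at A B C = angle_at B C A \<or>
     angle_at B C A = angle_at C A B \<or>
     angle_at C A B = angle_at A B C"

text \<open>Reflection of the plane across the line through the origin spanned by \<open>u \<noteq> 0\<close>.\<close>

definition line_reflection :: "real^2 \<Rightarrow> real^2 \<Rightarrow> real^2" where
  "line_reflection u x = (2 * (x \<bullet> u) / (u \<bullet> u)) *\<^sub>R u - x"

text \<open>The reflections across the directions of the sides opposite \<open>A\<close>, \<open>B\<close>, \<open>C\<close>.\<close>

definition side_reflections :: "real^2 \<Rightarrow> real^2 \<Rightarrow> real^2 \<Rightarrow> (real^2 \<Rightarrow> real^2) set" where
  "side_reflections A B C =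
     {line_reflection (C - B), line_reflection (A - C), line_reflection (B - A)}"

text \<open>The group generated by the three reflections; multiplication in \<open>BijGroup UNIV\<close> is
  composition of maps. If the angles are \<open>p\<^sub>i * pi / n\<close> with \<open>n = p\<^sub>1 + p\<^sub>2 + p\<^sub>3\<close> and coprime
  \<open>p\<^sub>1, p\<^sub>2, p\<^sub>3\<close>, this is the dihedral group of order \<open>2 * n\<close>.\<close>

definition reflection_group :: "real^2 \<Rightarrow> real^2 \<Rightarrow> real^2 \<Rightarrow> (real^2 \<Rightarrow> real^2) monoid" where
  "reflection_group A B C =
     (BijGroup UNIV)\<lparr>carrier := generate (BijGroup UNIV) (side_reflections A B C)\<rparr>"


section \<open>Undirected graphs and Cayley graphs\<close>

text \<open>A graph is a pair of its vertex set and its set of edges, an edge being the set of its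
  two endpoints.\<close>

type_synonym 'v ugraph = "'v set \<times> 'v set set"

definition cayley_graph :: "('a, 'b) monoid_scheme \<Rightarrow> 'a set \<Rightarrow> 'a ugraph" where
  "cayley_graph G S =
     (carrier G, {{\<sigma>, \<sigma> \<otimes>\<^bsub>G\<^esub> s} | \<sigma> s. \<sigma> \<in> carrier G \<and> s \<in> S})"

definition triangle_graph :: "real^2 \<Rightarrow> real^2 \<Rightarrow> real^2 \<Rightarrow> (real^2 \<Rightarrow> real^2) ugraph" where
  "triangle_graph A B C = cayley_graph (reflection_group A B C) (side_reflections A B C)"


section \<open>Closed orientable surfaces\<close>

text \<open>For \<open>g \<ge> 1\<close> the closed orientable surface of genus \<open>g\<close> is the regular \<open>4g\<close>-gon with its
  sides identified in pairs according to the word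
  \<open>a\<^sub>1 b\<^sub>1 a\<^sub>1\<inverse> b\<^sub>1\<inverse> \<dots> a\<^sub>g b\<^sub>g a\<^sub>g\<inverse> b\<^sub>g\<inverse>\<close>: side \<open>4j + i\<close> is glued to side \<open>4j + i + 2\<close>
  (\<open>i = 0, 1\<close>) with reversed orientation.\<close>

definition polygon_vertex :: "nat \<Rightarrow> nat \<Rightarrow> complex" where
  "polygon_vertex g k = cis (2 * pi * real k / real (4 * g))"

definition polygon :: "nat \<Rightarrow> complex set" where
  "polygon g = convex hull (polygon_vertex g ` {..<4 * g})"

definition polygon_side :: "nat \<Rightarrow> nat \<Rightarrow> real \<Rightarrow> complex" where
  "polygon_side g k = linepath (polygon_vertex g k) (polygon_vertex g (Suc k))"

definition side_pairing :: "nat \<Rightarrow> complex \<Rightarrow> complex \<Rightarrow> bool" where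
  "side_pairing g z w \<longleftrightarrow>
     (\<exists>j<g. \<exists>i\<in>{0, 1}. \<exists>t\<in>{0..1}.
        z = polygon_side g (4 * j + i) t \<and> w = polygon_side g (4 * j + i + 2) (1 - t))"

text \<open>Surfaces are taken as subspaces of three-dimensional space. This loses nothing: every
  closed orientable surface embeds there, and the predicate is invariant under homeomorphism.\<close>

definition closed_orientable_surface :: "nat \<Rightarrow> (real^3) set \<Rightarrow> bool" where
  "closed_orientable_surface g S \<longleftrightarrow>
     (if g = 0 then S homeomorphic sphere (0 :: real^3) 1
      else \<exists>q. quotient_map (top_of_set (polygon g)) (top_of_set S) q \<and>
             (\<forall>z\<in>polygon g. \<forall>w\<in>polygon g. q z = q w \<longleftrightarrow> equivclp (side_pairing g) z w))"


section \<open>Drawings without crossings and the genus of a graph\<close>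

definition drawable_on :: "'v ugraph \<Rightarrow> (real^3) set \<Rightarrow> bool" where
  "drawable_on \<Gamma> S \<longleftrightarrow>
     (\<exists>(pos :: 'v \<Rightarrow> real^3) (curve :: 'v set \<Rightarrow> real \<Rightarrow> real^3).
        inj_on pos (fst \<Gamma>) \<and> pos ` fst \<Gamma> \<subseteq> S \<and>
        (\<forall>e\<in>snd \<Gamma>.
           arc (curve e) \<and> path_image (curve e) \<subseteq> S \<and>
           {pathstart (curve e), pathfinish (curve e)} = pos ` e \<and>
           path_image (curve e) \<inter> pos ` fst \<Gamma> = pos ` e) \<and>
        (\<forall>e\<in>snd \<Gamma>. \<forall>f\<in>snd \<Gamma>. e \<noteq> f \<longrightarrow>
           path_image (curve e) \<inter> path_image (curve f) \<subseteq> pos ` (e \<inter> f)))"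

definition graph_genus :: "'v ugraph \<Rightarrow> nat" where
  "graph_genus \<Gamma> = (LEAST g. \<exists>S. closed_orientable_surface g S \<and> drawable_on \<Gamma> S)"

end

theory Submission
  imports Defs "HOL-Number_Theory.Cong"
begin

text \<open>Indexing the rotations and the reflections of the dihedral group by the integers modulo \<open>n\<close>, the
  Cayley graph joins \<open>R x\<close> to \<open>F (x + s)\<close> for \<open>s \<in> {0, p\<^sub>1, - p\<^sub>2}\<close>. This is the quotient of the
  hexagonal tiling of the plane by a lattice of index \<open>n\<close>, so it embeds in the torus. If two of the
  \<open>p\<^sub>i\<close> agree and \<open>n\<close> is even, it is a prism and hence planar.

  Otherwise let \<open>d\<close> be the greatest common divisor of some \<open>p\<^sub>i\<close> and \<open>n\<close>. The edges of two of the
  three colours form \<open>d\<close> disjoint cycles. From three consecutive rotations on one of them, parallel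
  paths lead across all the other cycles back to it, and if their ends are far enough from their
  starting points, the cycle together with these three crossing chords is a subdivision of the
  complete bipartite graph on three plus three vertices. For \<open>d = 1\<close> this works if \<open>p\<^sub>i\<close> differs from the other two
  numbers, which covers the isosceles triangles with odd \<open>n\<close> except the equilateral one, whose graph
  is the complete bipartite graph itself. If no \<open>p\<^sub>i\<close> is coprime to \<open>n\<close>, the three divisors are
  pairwise coprime, so one of them is at least \<open>5\<close>, and there is enough choice for the chords.\<close>

section \<open>Theta curves in the plane and on the sphere\<close>

text \<open>The differences \<open>0\<close>, \<open>p\<^sub>1\<close>, \<open>- p\<^sub>2\<close>
  arise because a reflection is governed by twice the angle of its axis, and at the two ends of one
  side the other two sides turn away in opposite senses. Since \<open>p\<^sub>3\<close> is congruent
  to \<open>- p\<^sub>1 - p\<^sub>2\<close> modulo \<open>n\<close>, renaming the vertices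
  cyclically puts any of the three numbers first. The obstacle is the length of the chords. On a
  cycle of length \<open>2 * M\<close> a chord advances by \<open>2 * l - 1\<close>, and three
  consecutive chords serve only if their six ends occur as starts, then ends, which is
  \<open>3 \<le> l \<le> M - 2\<close>. With a single cycle and \<open>q = - p\<^sub>2\<close>, the
  excluded values \<open>2\<close> and \<open>-1\<close> of \<open>l\<close> say exactly
  \<open>p\<^sub>1 = p\<^sub>3\<close> and \<open>p\<^sub>1 = p\<^sub>2\<close>, so equal angles are
  what saves planarity. With several cycles, \<open>l\<close> can be lowered by one at each cycle
  crossed on the way, and five choices repair every bad value. The constant \<open>5\<close> is
  always reached: among three pairwise coprime numbers above \<open>1\<close>, at most one is even
  and at most one equals \<open>3\<close>.\<close>

lemma simple_closed_curve_from_arcs: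
  assumes "arc g" "arc h" "pathstart g = x" "pathfinish g = y" "pathstart h = x" "pathfinish h = y"
    and "path_image g \<inter> path_image h = {x, y}"
  obtains c where "simple_path c" "pathfinish c = pathstart c"
    "path_image c = path_image g \<union> path_image h"
proof
  show "simple_path (g +++ reversepath h)"
    using assms by (intro simple_path_join_loop) (auto simp: arc_reversepath)
qed (use assms in \<open>auto simp: path_image_join\<close>)

lemma connected_arc_endless:
  assumes "arc g"
  shows "connected (path_image g - {pathstart g, pathfinish g})"
  using assms connected_simple_path_endless[OF arc_imp_simple_path] by blast

lemma unbounded_connected_subset_outside:
  fixes S :: "'a::real_normed_vector set"
  assumes "connected Q" "\<not> bounded Q" "Q \<inter> S = {}"
  shows "Q \<subseteq> outside S"
proof
  fix a assume a: "a \<in> Q"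
  then have "Q \<subseteq> connected_component_set (- S) a"
    using assms by (intro connected_component_maximal) auto
  then show "a \<in> outside S"
    using a assms bounded_subset unfolding outside_def by blast
qed

text \<open>The inside of the first cycle is connected and misses the second cycle, because
  \<open>k\<close> stays outside. It has \<open>g\<close> on its frontier, and \<open>g\<close>
  enters the open outside of the second cycle, so the two regions meet; connectedness does the
  rest.\<close>

lemma inside_subset_outside:
  fixes g h k :: "real \<Rightarrow> complex"
  assumes arcs: "arc g" "arc h" "arc k"
    and "pathstart g = x" "pathfinish g = y" "pathstart h = x" "pathfinish h = y"
      "pathstart k = x" "pathfinish k = y"
    and gh: "path_image g \<inter> path_image h = {x, y}" and hk: "path_image h \<inter> path_image k = {x, y}"
    and gk: "path_image g \<inter> path_image k = {x, y}"
    and k: "path_image k - {x, y} \<subseteq> outside (path_image g \<union> path_image h)"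
    and g: "path_image g - {x, y} \<subseteq> outside (path_image h \<union> path_image k)"
  shows "inside (path_image g \<union> path_image h) \<subseteq> outside (path_image h \<union> path_image k)"
proof -
  let ?I = "inside (path_image g \<union> path_image h)" and ?O = "outside (path_image h \<union> path_image k)"
  obtain c where c: "simple_path c" "pathfinish c = pathstart c"
    "path_image c = path_image g \<union> path_image h"
    by (rule simple_closed_curve_from_arcs[OF arcs(1,2), of x y]) (use assms in auto)
  obtain c' where c': "simple_path c'" "pathfinish c' = pathstart c'"
    "path_image c' = path_image h \<union> path_image k"
    by (rule simple_closed_curve_from_arcs[OF arcs(2,3), of x y]) (use assms in auto)
  note J = Jordan_inside_outside[OF c(1,2), unfolded c(3)]
  note J' = Jordan_inside_outside[OF c'(1,2), unfolded c'(3)]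
  have xy: "{x, y} \<subseteq> path_image h" using gh by blast
  have "?I \<inter> (path_image g \<union> path_image h) = {}" by (rule inside_no_overlap)
  moreover have "?I \<inter> outside (path_image g \<union> path_image h) = {}" by (rule inside_Int_outside)
  ultimately have disj: "?I \<inter> (path_image h \<union> path_image k) = {}"
    using k xy by blast
  have "path_image g - {x, y} \<noteq> {}"
    using arcs(1) assms(4,5) arc_imp_simple_path nonempty_simple_path_endless by blast
  then obtain a where a: "a \<in> path_image g" "a \<in> ?O" using g by blast
  have "a \<in> frontier ?I" using J a by blast
  then have "a \<in> closure ?I" by (simp add: frontier_def)
  moreover have "open ?O" using J' by blast
  ultimately have "?O \<inter> ?I \<noteq> {}" using a(2) open_Int_closure_eq_empty[of ?O ?I] by auto
  then obtain b where b: "b \<in> ?O" "b \<in> ?I" by blast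
  have "?I \<subseteq> connected_component_set (- (path_image h \<union> path_image k)) b"
    using J disj b by (intro connected_component_maximal) auto
  moreover have "connected_component_set (- (path_image h \<union> path_image k)) b \<subseteq> ?O"
    using b(1) outside_same_component by blast
  ultimately show ?thesis by blast
qed

text \<open>If no arc of a theta curve lies inside the other two, the inside of two of them lies outside
  either of the remaining cycles, whose intersection is an arc, so Janiszewski's theorem connects
  it to infinity in the complement of the theta curve.\<close>

lemma theta_curve_middle_arc:
  fixes g h k :: "real \<Rightarrow> complex"
  assumes arcs: "arc g" "arc h" "arc k"
    and ends: "pathstart g = x" "pathfinish g = y" "pathstart h = x" "pathfinish h = y"
      "pathstart k = x" "pathfinish k = y"
    and gh: "path_image g \<inter> path_image h = {x, y}" and hk: "path_image h \<inter> path_image k = {x, y}"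
    and gk: "path_image g \<inter> path_image k = {x, y}"
    and g: "path_image g - {x, y} \<subseteq> outside (path_image h \<union> path_image k)"
    and h: "path_image h - {x, y} \<subseteq> outside (path_image g \<union> path_image k)"
    and k: "path_image k - {x, y} \<subseteq> outside (path_image g \<union> path_image h)"
  shows False
proof -
  let ?I = "inside (path_image g \<union> path_image h)"
  have 1: "?I \<subseteq> outside (path_image h \<union> path_image k)"
    using inside_subset_outside[of g h k x y] assms by blast
  have 2: "?I \<subseteq> outside (path_image g \<union> path_image k)"
    using inside_subset_outside[of h g k x y] assms by (simp add: Un_commute Int_commute)
  obtain c where c: "simple_path c" "pathfinish c = pathstart c"
    "path_image c = path_image g \<union> path_image h"
    by (rule simple_closed_curve_from_arcs[OF arcs(1,2), of x y]) (use assms in auto)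
  note J = Jordan_inside_outside[OF c(1,2), unfolded c(3)]
  obtain p where p: "p \<in> ?I" using J by blast
  have comp: "compact (path_image g)" "compact (path_image h)" "compact (path_image k)"
    using arcs by (simp_all add: compact_arc_image)
  then have bdd: "bounded (path_image g \<union> path_image h \<union> path_image k)"
    by (simp add: compact_imp_bounded)
  have "outside (path_image g \<union> path_image h \<union> path_image k) \<noteq> {}"
    by (rule outside_bounded_nonempty[OF bdd])
  then obtain q where q: "q \<in> outside (path_image g \<union> path_image h \<union> path_image k)" by blast
  have same: "connected_component (- S) p q"
    if "p \<in> outside S" "S \<subseteq> path_image g \<union> path_image h \<union> path_image k" for S
  proof -
    have "q \<in> outside S" using q that(2) outside_mono by blast
    moreover have "bounded S" using bdd that(2) bounded_subset by blast
    then have "connected (outside S)" by (simp add: connected_outside)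
    moreover have "outside S \<subseteq> - S" using outside_no_overlap by blast
    ultimately show ?thesis using that(1) unfolding connected_component_def by blast
  qed
  have "connected_component (- ((path_image h \<union> path_image k) \<union> (path_image g \<union> path_image k))) p q"
  proof (rule Janiszewski)
    have "(path_image h \<union> path_image k) \<inter> (path_image g \<union> path_image k) = path_image k"
      using gh hk gk by blast
    then show "connected ((path_image h \<union> path_image k) \<inter> (path_image g \<union> path_image k))"
      using arcs by (simp add: connected_arc_image)
    show "connected_component (- (path_image h \<union> path_image k)) p q"
      "connected_component (- (path_image g \<union> path_image k)) p q"
      using 1 2 p by (intro same; blast)+
  qed (use comp in \<open>auto simp: compact_imp_closed\<close>)
  then have "connected_component (- (path_image g \<union> path_image h)) p q"
    by (rule connected_component_of_subset) auto
  moreover have "q \<in> outside (path_image g \<union> path_image h)"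
    using q outside_mono by blast
  ultimately have "p \<in> outside (path_image g \<union> path_image h)"
    using outside_same_component[of "path_image g \<union> path_image h" q p] connected_component_sym by blast
  then show False using p J by blast
qed

text \<open>An unbounded connected set that touches one arc and avoids the other two certifies that
  this arc is outside their cycle. In this form the hypotheses can be carried over from the sphere,
  where "outside" has no meaning.\<close>

lemma theta_curve_unbounded_pieces:
  fixes g h k :: "real \<Rightarrow> complex"
  assumes arcs: "arc g" "arc h" "arc k"
    and ends: "pathstart g = x" "pathfinish g = y" "pathstart h = x" "pathfinish h = y"
      "pathstart k = x" "pathfinish k = y"
    and gh: "path_image g \<inter> path_image h = {x, y}" and hk: "path_image h \<inter> path_image k = {x, y}"
    and gk: "path_image g \<inter> path_image k = {x, y}"
    and Qg: "connected Qg" "\<not> bounded Qg" "Qg \<inter> (path_image h \<union> path_image k) = {}" "Qg \<inter> path_image g \<noteq> {}"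
    and Qh: "connected Qh" "\<not> bounded Qh" "Qh \<inter> (path_image g \<union> path_image k) = {}" "Qh \<inter> path_image h \<noteq> {}"
    and Qk: "connected Qk" "\<not> bounded Qk" "Qk \<inter> (path_image g \<union> path_image h) = {}" "Qk \<inter> path_image k \<noteq> {}"
  shows False
proof -
  have *: "path_image f - {x, y} \<subseteq> outside S"
    if "arc f" "pathstart f = x" "pathfinish f = y" "path_image f \<inter> S = {x, y}"
      and Q: "connected Q" "\<not> bounded Q" "Q \<inter> S = {}" "Q \<inter> path_image f \<noteq> {}" for f :: "real \<Rightarrow> complex" and S Q
  proof -
    have "Q \<subseteq> outside S" using Q(1-3) by (rule unbounded_connected_subset_outside)
    moreover obtain a where a: "a \<in> Q" "a \<in> path_image f" using Q(4) by blast
    moreover have "a \<notin> {x, y}" using a that(4) Q(3) by blast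
    moreover have "connected (path_image f - {x, y})" using connected_arc_endless[OF that(1)] that(2,3) by simp
    then have "path_image f - {x, y} \<subseteq> connected_component_set (- S) a"
      using a \<open>a \<notin> {x, y}\<close> that(4) by (intro connected_component_maximal) auto
    ultimately show ?thesis using outside_same_component by blast
  qed
  show False
  proof (rule theta_curve_middle_arc[OF arcs ends gh hk gk])
    show "path_image g - {x, y} \<subseteq> outside (path_image h \<union> path_image k)"
      using gh gk by (intro *[OF _ _ _ _ Qg]) (use arcs ends in auto)
    show "path_image h - {x, y} \<subseteq> outside (path_image g \<union> path_image k)"
      using gh hk by (intro *[OF _ _ _ _ Qh]) (use arcs ends in auto)
    show "path_image k - {x, y} \<subseteq> outside (path_image g \<union> path_image h)"
      using hk gk by (intro *[OF _ _ _ _ Qk]) (use arcs ends in auto)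
  qed
qed

lemma punctured_sphere_homeomorphic_plane:
  assumes "S homeomorphic sphere (0 :: real^3) 1" "z \<in> S"
  shows "S - {z} homeomorphic (UNIV :: complex set)"
proof -
  obtain f g where fg: "homeomorphism S (sphere (0 :: real^3) 1) f g"
    using assms(1) unfolding homeomorphic_def by blast
  then have fz: "f z \<in> sphere 0 1" using assms(2) by (auto simp: homeomorphism_def)
  have "inj_on f S" using fg unfolding homeomorphism_def by (metis inj_on_inverseI)
  then have "f ` (S - {z}) = f ` S - f ` {z}"
    using assms(2) by (intro inj_on_image_set_diff) auto
  then have im: "f ` (S - {z}) = sphere 0 1 - {f z}" using fg by (auto simp: homeomorphism_def)
  have "homeomorphism (S - {z}) (sphere 0 1 - {f z}) f g"
    by (rule homeomorphism_of_subsets[OF fg]) (auto simp: im)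
  then have "S - {z} homeomorphic sphere 0 1 - {f z}" by (auto simp: homeomorphic_def)
  moreover have "sphere 0 1 - {f z} homeomorphic (UNIV :: complex set)"
    using fz by (intro homeomorphic_punctured_sphere_affine) auto
  ultimately show ?thesis by (rule homeomorphic_trans)
qed

text \<open>Removing \<open>z\<close> turns the sphere into the plane, and a set that accumulates at
  \<open>z\<close> becomes unbounded.\<close>

lemma theta_curve_on_sphere:
  fixes g h k :: "real \<Rightarrow> real^3"
  assumes S: "S homeomorphic sphere (0 :: real^3) 1" "z \<in> S"
    and arcs: "arc g" "arc h" "arc k"
    and sub: "path_image g \<subseteq> S - {z}" "path_image h \<subseteq> S - {z}" "path_image k \<subseteq> S - {z}"
    and ends: "pathstart g = x" "pathfinish g = y" "pathstart h = x" "pathfinish h = y"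
      "pathstart k = x" "pathfinish k = y"
    and gh: "path_image g \<inter> path_image h = {x, y}" and hk: "path_image h \<inter> path_image k = {x, y}"
    and gk: "path_image g \<inter> path_image k = {x, y}"
    and Qg: "connected Qg" "Qg \<subseteq> S - {z}" "z \<in> closure Qg" "Qg \<inter> (path_image h \<union> path_image k) = {}"
      "Qg \<inter> path_image g \<noteq> {}"
    and Qh: "connected Qh" "Qh \<subseteq> S - {z}" "z \<in> closure Qh" "Qh \<inter> (path_image g \<union> path_image k) = {}"
      "Qh \<inter> path_image h \<noteq> {}"
    and Qk: "connected Qk" "Qk \<subseteq> S - {z}" "z \<in> closure Qk" "Qk \<inter> (path_image g \<union> path_image h) = {}"
      "Qk \<inter> path_image k \<noteq> {}"
  shows False
proof -
  obtain \<phi> \<psi> where hom: "homeomorphism (S - {z}) (UNIV :: complex set) \<phi> \<psi>"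
    using punctured_sphere_homeomorphic_plane[OF S] unfolding homeomorphic_def by blast
  have inj: "inj_on \<phi> (S - {z})"
    using hom unfolding homeomorphism_def by (metis inj_on_inverseI)
  have cont: "continuous_on (S - {z}) \<phi>" using hom unfolding homeomorphism_def by blast
  have arc: "arc (\<phi> \<circ> f)" if "arc f" "path_image f \<subseteq> S - {z}" for f
  proof -
    have "f ` {0..1} \<subseteq> S - {z}" using that(2) by (simp add: path_image_def)
    then show ?thesis using that(1) unfolding arc_def path_def
      by (auto intro: continuous_on_compose2[OF cont] comp_inj_on inj_on_subset[OF inj])
  qed
  have connected: "connected (\<phi> ` Q)" if "connected Q" "Q \<subseteq> S - {z}" for Q
    using that cont connected_continuous_image continuous_on_subset by blast
  have unbounded: "\<not> bounded (\<phi> ` Q)" if Q: "Q \<subseteq> S - {z}" "z \<in> closure Q" for Q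
  proof
    assume "bounded (\<phi> ` Q)"
    \<comment> \<open>The compact closure in the plane pulls back to a closed set that contains
      \<open>Q\<close> but not \<open>z\<close>, against \<open>z\<close> being in the closure of
      \<open>Q\<close>.\<close>
    then have "compact (closure (\<phi> ` Q))" by (simp add: compact_closure)
    moreover have "continuous_on (closure (\<phi> ` Q)) \<psi>"
      using hom unfolding homeomorphism_def by (meson continuous_on_subset subset_UNIV)
    ultimately have cl: "closed (\<psi> ` closure (\<phi> ` Q))"
      using compact_continuous_image compact_imp_closed by blast
    have "Q \<subseteq> \<psi> ` closure (\<phi> ` Q)"
    proof
      fix u assume "u \<in> Q"
      then have "\<phi> u \<in> closure (\<phi> ` Q)" "\<psi> (\<phi> u) = u"
        using hom Q(1) closure_subset[of "\<phi> ` Q"] by (auto simp: homeomorphism_def)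
      then show "u \<in> \<psi> ` closure (\<phi> ` Q)" by (metis image_eqI)
    qed
    then have "closure Q \<subseteq> \<psi> ` closure (\<phi> ` Q)" using cl by (simp add: closure_minimal)
    also have "\<dots> \<subseteq> S - {z}" using hom by (auto simp: homeomorphism_def)
    finally show False using Q(2) by blast
  qed
  have meet: "\<phi> ` X \<inter> \<phi> ` Y = \<phi> ` (X \<inter> Y)" if "X \<subseteq> S - {z}" "Y \<subseteq> S - {z}" for X Y
    using inj_on_image_Int[OF inj that] by simp
  note [simp] = path_image_compose pathstart_compose pathfinish_compose
  have un: "\<phi> ` X \<union> \<phi> ` Y = \<phi> ` (X \<union> Y)" for X Y by blast
  show False
  proof (rule theta_curve_unbounded_pieces[of "\<phi> \<circ> g" "\<phi> \<circ> h" "\<phi> \<circ> k" "\<phi> x" "\<phi> y"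
        "\<phi> ` Qg" "\<phi> ` Qh" "\<phi> ` Qk"], goal_cases)
    case 1 show ?case by (rule arc[OF arcs(1) sub(1)])
  next case 2 show ?case by (rule arc[OF arcs(2) sub(2)])
  next case 3 show ?case by (rule arc[OF arcs(3) sub(3)])
  next case 10 show ?case using gh sub by (simp add: meet)
  next case 11 show ?case using hk sub by (simp add: meet)
  next case 12 show ?case using gk sub by (simp add: meet)
  next case 13 show ?case using Qg by (simp add: connected)
  next case 14 show ?case using Qg by (simp add: unbounded)
  next case 15 show ?case using Qg sub by (simp add: meet un)
  next case 16 show ?case using Qg sub by (simp add: meet)
  next case 17 show ?case using Qh by (simp add: connected)
  next case 18 show ?case using Qh by (simp add: unbounded)
  next case 19 show ?case using Qh sub by (simp add: meet un)
  next case 20 show ?case using Qh sub by (simp add: meet)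
  next case 21 show ?case using Qk by (simp add: connected)
  next case 22 show ?case using Qk by (simp add: unbounded)
  next case 23 show ?case using Qk sub by (simp add: meet un)
  next case 24 show ?case using Qk sub by (simp add: meet)
  qed (simp_all add: ends)
qed

section \<open>Vertex paths as arcs of a drawing\<close>

fun walk_edges :: "'v list \<Rightarrow> 'v set set" where
  "walk_edges (u # v # vs) = insert {u, v} (walk_edges (v # vs))"
| "walk_edges _ = {}"

definition path_in :: "'v set set \<Rightarrow> 'v list \<Rightarrow> bool" where
  "path_in E vs \<longleftrightarrow> distinct vs \<and> successively (\<lambda>u v. {u, v} \<in> E) vs"

lemma walk_edges_subset: "e \<in> walk_edges vs \<Longrightarrow> e \<subseteq> set vs"
  by (induction vs rule: walk_edges.induct) auto

lemma walk_edges_nonempty: "e \<in> walk_edges vs \<Longrightarrow> e \<noteq> {}"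
  by (induction vs rule: walk_edges.induct) auto

lemma path_in_walk_edges: "path_in E vs \<Longrightarrow> walk_edges vs \<subseteq> E"
  unfolding path_in_def by (induction vs rule: walk_edges.induct) auto

lemma Union_walk_edges: "length vs \<ge> 2 \<Longrightarrow> \<Union> (walk_edges vs) = set vs"
proof (induction vs rule: walk_edges.induct)
  case (1 u v vs)
  then show ?case by (cases vs) auto
qed auto

lemma ends_not_walk_edge:
  assumes "distinct (x # L @ [y])" "L \<noteq> []"
  shows "{x, y} \<notin> walk_edges (x # L @ [y])"
proof
  assume "{x, y} \<in> walk_edges (x # L @ [y])"
  moreover obtain a L' where L: "L = a # L'" using assms(2) by (cases L) auto
  ultimately have "{x, y} = {x, a} \<or> {x, y} \<in> walk_edges (L @ [y])" by simp
  then show False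
  proof
    assume "{x, y} = {x, a}"
    then show False using assms L by (auto simp: doubleton_eq_iff)
  next
    assume "{x, y} \<in> walk_edges (L @ [y])"
    then have "x \<in> set (L @ [y])" using walk_edges_subset[of "{x, y}" "L @ [y]"] by simp
    then show False using assms(1) by simp
  qed
qed

locale drawing =
  fixes V :: "'v set" and E :: "'v set set" and S :: "(real^3) set"
    and pos :: "'v \<Rightarrow> real^3" and curve :: "'v set \<Rightarrow> real \<Rightarrow> real^3"
  assumes edge_subset: "e \<in> E \<Longrightarrow> e \<subseteq> V"
    and inj_pos: "inj_on pos V"
    and arc_curve: "e \<in> E \<Longrightarrow> arc (curve e)"
    and curve_in: "e \<in> E \<Longrightarrow> path_image (curve e) \<subseteq> S"
    and curve_ends: "e \<in> E \<Longrightarrow> {pathstart (curve e), pathfinish (curve e)} = pos ` e"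
    and curve_vertices: "e \<in> E \<Longrightarrow> path_image (curve e) \<inter> pos ` V = pos ` e"
    and curve_inter: "\<lbrakk>e \<in> E; f \<in> E; e \<noteq> f\<rbrakk> \<Longrightarrow> path_image (curve e) \<inter> path_image (curve f) \<subseteq> pos ` (e \<inter> f)"
begin

definition trace :: "'v list \<Rightarrow> (real^3) set" where
  "trace vs = (\<Union>e\<in>walk_edges vs. path_image (curve e))"

lemma trace_inter:
  assumes "path_in E vs" "path_in E ws" "walk_edges vs \<inter> walk_edges ws = {}"
  shows "trace vs \<inter> trace ws \<subseteq> pos ` (set vs \<inter> set ws)"
proof
  fix u assume "u \<in> trace vs \<inter> trace ws"
  then obtain e f where ef: "e \<in> walk_edges vs" "f \<in> walk_edges ws"
    "u \<in> path_image (curve e)" "u \<in> path_image (curve f)"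
    unfolding trace_def by blast
  then have "e \<in> E" "f \<in> E" "e \<noteq> f"
    using assms(3) path_in_walk_edges[OF assms(1)] path_in_walk_edges[OF assms(2)] by blast+
  then have "u \<in> pos ` (e \<inter> f)" using ef curve_inter[of e f] by blast
  then show "u \<in> pos ` (set vs \<inter> set ws)"
    using walk_edges_subset[OF ef(1)] walk_edges_subset[OF ef(2)] by blast
qed

lemma pos_in_trace:
  assumes "path_in E vs" "length vs \<ge> 2" "v \<in> set vs"
  shows "pos v \<in> trace vs"
proof -
  obtain e where "e \<in> walk_edges vs" "v \<in> e" using Union_walk_edges[OF assms(2)] assms(3) by blast
  moreover from this have "pos v \<in> path_image (curve e)"
    using path_in_walk_edges[OF assms(1)] curve_vertices[of e] by blast
  ultimately show ?thesis by (auto simp: trace_def)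
qed

lemma trace_arc:
  assumes "path_in E vs" "length vs \<ge> 2"
  shows "\<exists>g. arc g \<and> pathstart g = pos (hd vs) \<and> pathfinish g = pos (last vs) \<and> path_image g = trace vs"
  using assms
proof (induction vs rule: walk_edges.induct)
  case (1 u v vs)
  have uv: "{u, v} \<in> E" "u \<noteq> v" using "1.prems" by (auto simp: path_in_def)
  have "{pathstart (curve {u, v}), pathfinish (curve {u, v})} = {pos u, pos v}"
    using curve_ends[OF uv(1)] by simp
  \<comment> \<open>An edge is a set, so its curve may run either way and has to be reversed in one
    of the cases.\<close>
  then have "pathstart (curve {u, v}) = pos u \<and> pathfinish (curve {u, v}) = pos v \<or>
    pathstart (curve {u, v}) = pos v \<and> pathfinish (curve {u, v}) = pos u"
    by (auto simp: doubleton_eq_iff)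
  then obtain g where g: "arc g" "pathstart g = pos u" "pathfinish g = pos v"
    "path_image g = path_image (curve {u, v})"
    using arc_curve[OF uv(1)]
    by (metis arc_reversepath path_image_reversepath pathfinish_reversepath pathstart_reversepath)
  show ?case
  proof (cases "vs = []")
    case True
    then show ?thesis using g by (auto simp: trace_def)
  next
    case False
    have path: "path_in E (v # vs)" using "1.prems" by (auto simp: path_in_def)
    moreover have "length (v # vs) \<ge> 2" using False by (cases vs) auto
    ultimately obtain h where h: "arc h" "pathstart h = pos v" "pathfinish h = pos (last (v # vs))"
      "path_image h = trace (v # vs)" using "1.IH" by auto
    have u: "u \<notin> set (v # vs)" using "1.prems" by (auto simp: path_in_def)
    then have "walk_edges [u, v] \<inter> walk_edges (v # vs) = {}"
      using walk_edges_subset[of _ "v # vs"] by force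
    then have "trace [u, v] \<inter> trace (v # vs) \<subseteq> pos ` (set [u, v] \<inter> set (v # vs))"
      using path uv by (intro trace_inter) (auto simp: path_in_def)
    then have "path_image g \<inter> path_image h \<subseteq> {pathstart h}"
      using u g(4) h(2,4) by (auto simp: trace_def)
    then have "arc (g +++ h)" using g h by (intro arc_join) auto
    moreover have "path_image (g +++ h) = trace (u # v # vs)"
      using g h by (simp add: path_image_join trace_def)
    ultimately show ?thesis using g h False by (intro exI[of _ "g +++ h"]) auto
  qed
qed auto

lemma path_in_vertices:
  assumes "path_in E vs" "length vs \<ge> 2"
  shows "set vs \<subseteq> V"
  using path_in_walk_edges[OF assms(1)] Union_walk_edges[OF assms(2)] edge_subset by blast

text \<open>A shared edge would join \<open>x\<close> and \<open>y\<close> directly, since the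
  interiors are disjoint, but a path with nonempty interior does not contain that edge.\<close>

lemma trace_meets:
  assumes "path_in E (x # L @ [y])" "path_in E (x # M @ [y])" "L \<noteq> []" "M \<noteq> []" "set L \<inter> set M = {}"
  shows "trace (x # L @ [y]) \<inter> trace (x # M @ [y]) = {pos x, pos y}"
proof
  have "walk_edges (x # L @ [y]) \<inter> walk_edges (x # M @ [y]) = {}"
  proof (rule ccontr)
    assume "\<not> ?thesis"
    then obtain e where e: "e \<in> walk_edges (x # L @ [y])" "e \<in> walk_edges (x # M @ [y])" by blast
    then have "e \<subseteq> {x, y}" using walk_edges_subset[OF e(1)] walk_edges_subset[OF e(2)] assms(5) by auto
    moreover have "e \<in> E" using e(1) path_in_walk_edges[OF assms(1)] by blast
    \<comment> \<open>A loop is impossible: its curve would be an arc with equal ends.\<close>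
    then have "\<not> (\<exists>v. e \<subseteq> {v})"
    proof safe
      fix v assume *: "e \<in> E" "e \<subseteq> {v}"
      then have "{pathstart (curve e), pathfinish (curve e)} \<subseteq> {pos v}" using curve_ends by blast
      then show False using arc_distinct_ends[OF arc_curve[OF *(1)]] by simp
    qed
    ultimately have "e = {x, y}" by blast
    then show False using e(1) ends_not_walk_edge[of x L y] assms(1,3) by (simp add: path_in_def)
  qed
  then show "trace (x # L @ [y]) \<inter> trace (x # M @ [y]) \<subseteq> {pos x, pos y}"
    using trace_inter[OF assms(1,2)] assms(5) by auto
  show "{pos x, pos y} \<subseteq> trace (x # L @ [y]) \<inter> trace (x # M @ [y])"
    using pos_in_trace[OF assms(1)] pos_in_trace[OF assms(2)] by simp
qed

lemma trace_subset: "path_in E vs \<Longrightarrow> trace vs \<subseteq> S"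
  using path_in_walk_edges[of E vs] curve_in by (force simp: trace_def)

lemma trace_vertices:
  assumes "path_in E vs" "v \<in> V" "pos v \<in> trace vs"
  shows "v \<in> set vs"
proof -
  obtain e where e: "e \<in> walk_edges vs" "pos v \<in> path_image (curve e)"
    using assms(3) unfolding trace_def by blast
  then have "e \<in> E" using path_in_walk_edges[OF assms(1)] by blast
  then have "pos v \<in> pos ` e" using curve_vertices[of e] e assms(2) by blast
  then have "v \<in> e" using inj_pos assms(2) edge_subset[OF \<open>e \<in> E\<close>] by (auto dest: inj_onD)
  then show ?thesis using walk_edges_subset[OF e(1)] by blast
qed

lemma trace_disjoint:
  assumes "path_in E vs" "path_in E ws" "set vs \<inter> set ws = {}"
  shows "trace vs \<inter> trace ws = {}"
proof -
  have "walk_edges vs \<inter> walk_edges ws = {}"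
    using assms(3) walk_edges_subset[of _ vs] walk_edges_subset[of _ ws] walk_edges_nonempty[of _ vs] by fast
  then show ?thesis using trace_inter[OF assms(1,2)] assms(3) by simp
qed

text \<open>A path ending in \<open>z\<close>, without its last point, is the connected set
  accumulating at \<open>z\<close> that \<open>theta_curve_on_sphere\<close> asks for.\<close>

lemma endless_trace:
  assumes "path_in E vs" "length vs \<ge> 2"
  shows "connected (trace vs - {pos (last vs)})" "pos (last vs) \<in> closure (trace vs - {pos (last vs)})"
proof -
  obtain g where g: "arc g" "pathstart g = pos (hd vs)" "pathfinish g = pos (last vs)"
    "path_image g = trace vs"
    using trace_arc[OF assms] by blast
  have inj: "inj_on g {0..1}" and cont: "continuous_on {0..1} g"
    using g(1) by (auto simp: arc_def path_def)
  have "g ` {0..1} - {g 1} = g ` ({0..1} - {1})"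
    using inj by (auto simp: inj_on_def)
  also have "{0..1} - {1} = {0..<1::real}" by auto
  finally have eq: "trace vs - {pos (last vs)} = g ` {0..<1}"
    using g by (simp add: path_image_def pathfinish_def)
  show "connected (trace vs - {pos (last vs)})"
    unfolding eq by (intro connected_continuous_image continuous_on_subset[OF cont]) auto
  have "g ` closure {0..<1} \<subseteq> closure (g ` {0..<1})"
    by (rule image_closure_subset) (use cont closure_subset[of "g ` {0..<1}"] in auto)
  then show "pos (last vs) \<in> closure (trace vs - {pos (last vs)})"
    unfolding eq using g(3) imageI[of 1 "{0..1}" g] by (auto simp: pathfinish_def)
qed

text \<open>Moving the vertex \<open>z\<close> to infinity, each of the three paths from \<open>x\<close> to \<open>y\<close> would have to
  lie outside the cycle formed by the other two.\<close>

theorem sphere_no_K33_subdivision: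
  assumes S: "S homeomorphic sphere (0 :: real^3) 1" and pos_in: "pos ` V \<subseteq> S"
    and L: "path_in E (x # La @ [y])" "path_in E (x # Lb @ [y])" "path_in E (x # Lc @ [y])"
    and ne: "La \<noteq> []" "Lb \<noteq> []" "Lc \<noteq> []"
    and disj: "set La \<inter> set Lb = {}" "set Lb \<inter> set Lc = {}" "set La \<inter> set Lc = {}"
    and z: "z \<notin> {x, y} \<union> set La \<union> set Lb \<union> set Lc"
    and Ma: "path_in E Ma" "last Ma = z" "set Ma \<inter> set La \<noteq> {}" "set Ma \<inter> ({x, y} \<union> set Lb \<union> set Lc) = {}"
    and Mb: "path_in E Mb" "last Mb = z" "set Mb \<inter> set Lb \<noteq> {}" "set Mb \<inter> ({x, y} \<union> set La \<union> set Lc) = {}"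
    and Mc: "path_in E Mc" "last Mc = z" "set Mc \<inter> set Lc \<noteq> {}" "set Mc \<inter> ({x, y} \<union> set La \<union> set Lb) = {}"
  shows False
proof -
  \<comment> \<open>Besides \<open>z\<close>, the path contains a vertex of \<open>T\<close>. The
    value of \<open>last\<close> on the empty list is harmless, as the empty list meets no
    \<open>T\<close>.\<close>
  have long: "length M \<ge> 2" if M: "last M = z" "set M \<inter> T \<noteq> {}" "z \<notin> T" for M T
    using M by (cases M rule: walk_edges.cases) auto
  have len: "length Ma \<ge> 2" "length Mb \<ge> 2" "length Mc \<ge> 2"
    using long[OF Ma(2,3)] long[OF Mb(2,3)] long[OF Mc(2,3)] z by blast+
  have "z \<in> set Ma" using Ma(2) len(1) by (cases Ma rule: rev_cases) auto
  then have zV: "z \<in> V" using path_in_vertices[OF Ma(1) len(1)] by blast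
  have theta: "trace (x # L @ [y]) \<subseteq> S - {pos z}" if "path_in E (x # L @ [y])" "z \<notin> {x, y} \<union> set L" for L
    using trace_subset[OF that(1)] trace_vertices[OF that(1) zV] that(2) by auto
  have avoid: "(trace M - {pos z}) \<inter> (trace (x # L @ [y]) \<union> trace (x # L' @ [y])) = {}"
    if "path_in E M" "set M \<inter> ({x, y} \<union> set L \<union> set L') = {}" "path_in E (x # L @ [y])" "path_in E (x # L' @ [y])"
    for M L L'
    using trace_disjoint[OF that(1,3)] trace_disjoint[OF that(1,4)] that(2) by auto
  have hit: "(trace M - {pos z}) \<inter> trace (x # L @ [y]) \<noteq> {}"
    if M: "path_in E M" "length M \<ge> 2" "set M \<inter> set L \<noteq> {}" "z \<notin> set L" "path_in E (x # L @ [y])" for M L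
  proof -
    obtain v where v: "v \<in> set M" "v \<in> set L" using M by blast
    then have "v \<in> V" "v \<noteq> z" using path_in_vertices[OF M(1,2)] M(4) by blast+
    then have "pos v \<noteq> pos z" using inj_pos zV by (auto dest: inj_onD)
    then show ?thesis using pos_in_trace[of M v] pos_in_trace[of "x # L @ [y]" v] M v by auto
  qed
  obtain ga where ga: "arc ga" "pathstart ga = pos x" "pathfinish ga = pos y"
    "path_image ga = trace (x # La @ [y])" using trace_arc[OF L(1)] by auto
  obtain gb where gb: "arc gb" "pathstart gb = pos x" "pathfinish gb = pos y"
    "path_image gb = trace (x # Lb @ [y])" using trace_arc[OF L(2)] by auto
  obtain gc where gc: "arc gc" "pathstart gc = pos x" "pathfinish gc = pos y"
    "path_image gc = trace (x # Lc @ [y])" using trace_arc[OF L(3)] by auto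
  note E = endless_trace[OF Ma(1) len(1)] endless_trace[OF Mb(1) len(2)] endless_trace[OF Mc(1) len(3)]
  note E = E[unfolded Ma(2) Mb(2) Mc(2)]
  have Sz: "pos z \<in> S" using pos_in zV by blast
  have sub: "trace M - {pos z} \<subseteq> S - {pos z}" if "path_in E M" for M
    using trace_subset[OF that] by blast
  show False
  proof (rule theta_curve_on_sphere[OF S Sz ga(1) gb(1) gc(1) _ _ _ ga(2,3) gb(2,3) gc(2,3),
        of "trace Ma - {pos z}" "trace Mb - {pos z}" "trace Mc - {pos z}"],
      unfold ga(4) gb(4) gc(4), goal_cases)
    case 1 show ?case using theta[OF L(1)] z by blast
  next case 2 show ?case using theta[OF L(2)] z by blast
  next case 3 show ?case using theta[OF L(3)] z by blast
  next case 4 show ?case by (rule trace_meets[OF L(1,2) ne(1,2) disj(1)])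
  next case 5 show ?case by (rule trace_meets[OF L(2,3) ne(2,3) disj(2)])
  next case 6 show ?case by (rule trace_meets[OF L(1,3) ne(1,3) disj(3)])
  next case 7 show ?case by (rule E(1))
  next case 8 show ?case by (rule sub[OF Ma(1)])
  next case 9 show ?case by (rule E(2))
  next case 10 show ?case by (rule avoid[OF Ma(1,4) L(2,3)])
  next case 11 show ?case using hit[OF Ma(1) len(1) Ma(3) _ L(1)] z by blast
  next case 12 show ?case by (rule E(3))
  next case 13 show ?case by (rule sub[OF Mb(1)])
  next case 14 show ?case by (rule E(4))
  next case 15 show ?case by (rule avoid[OF Mb(1,4) L(1,3)])
  next case 16 show ?case using hit[OF Mb(1) len(2) Mb(3) _ L(2)] z by blast
  next case 17 show ?case by (rule E(5))
  next case 18 show ?case by (rule sub[OF Mc(1)])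
  next case 19 show ?case by (rule E(6))
  next case 20 show ?case by (rule avoid[OF Mc(1,4) L(1,2)])
  next case 21 show ?case using hit[OF Mc(1) len(3) Mc(3) _ L(3)] z by blast
  qed
qed

end

section \<open>The torus as an identified square\<close>

text \<open>All conditions on crossings are condensed into one on parameters: \<open>e = f\<close>
  yields injectivity of each curve, and distinct edges can meet only at end parameters. As every
  vertex is the end of some edge, a curve running through a vertex is also a meeting of two
  curves.\<close>

lemma drawable_onI:
  fixes pos :: "'v \<Rightarrow> real^3"
  assumes inj: "inj_on pos V" and posS: "pos ` V \<subseteq> S" and covered: "V \<subseteq> \<Union> E"
    and edge: "\<And>e. e \<in> E \<Longrightarrow> e = {src e, tgt e}" "\<And>e. e \<in> E \<Longrightarrow> src e \<noteq> tgt e"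
      "\<And>e. e \<in> E \<Longrightarrow> e \<subseteq> V"
    and curve: "\<And>e. e \<in> E \<Longrightarrow> path (curve e)" "\<And>e. e \<in> E \<Longrightarrow> path_image (curve e) \<subseteq> S"
      "\<And>e. e \<in> E \<Longrightarrow> curve e 0 = pos (src e)" "\<And>e. e \<in> E \<Longrightarrow> curve e 1 = pos (tgt e)"
    and cross: "\<And>e f s t. \<lbrakk>e \<in> E; f \<in> E; s \<in> {0..1}; t \<in> {0..1}; curve e s = curve f t\<rbrakk>
       \<Longrightarrow> e = f \<and> s = t \<or> s \<in> {0, 1} \<and> t \<in> {0, 1}"
  shows "drawable_on (V, E) S"
proof -
  have ends: "curve e ` {0, 1} = pos ` e" if "e \<in> E" for e
    by (subst (2) edge(1)[OF that]) (use curve(3,4)[OF that] in auto)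
  have arc: "arc (curve e)" if e: "e \<in> E" for e
  proof -
    have "pos (src e) \<noteq> pos (tgt e)"
      using inj_onD[OF inj, of "src e" "tgt e"] edge[OF e] by auto
    then have "curve e 0 \<noteq> curve e 1" using curve[OF e] by simp
    then have "inj_on (curve e) {0..1}"
      using cross[OF e e] by (intro inj_onI) (metis insertE singletonD)
    then show ?thesis using curve(1)[OF e] by (simp add: arc_def)
  qed
  have vertices: "path_image (curve e) \<inter> pos ` V = pos ` e" if e: "e \<in> E" for e
  proof
    show "path_image (curve e) \<inter> pos ` V \<subseteq> pos ` e"
    proof
      fix u assume "u \<in> path_image (curve e) \<inter> pos ` V"
      then obtain s v where s: "s \<in> {0..1}" "u = curve e s" and v: "v \<in> V" "u = pos v"
        by (auto simp: path_image_def)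
      obtain f where f: "f \<in> E" "v \<in> f" using v covered by blast
      then obtain t where t: "t \<in> {0, 1}" "u = curve f t" using ends[OF f(1)] v by blast
      then have "e = f \<and> s = t \<or> s \<in> {0, 1} \<and> t \<in> {0, 1}"
        using cross[OF e f(1) s(1), of t] s by auto
      then show "u \<in> pos ` e" using t s ends[OF e] by blast
    qed
    have "pos ` e \<subseteq> path_image (curve e)"
      unfolding ends[OF e, symmetric] path_image_def by (intro image_mono) auto
    then show "pos ` e \<subseteq> path_image (curve e) \<inter> pos ` V" using edge(3)[OF e] by blast
  qed
  have meet: "path_image (curve e) \<inter> path_image (curve f) \<subseteq> pos ` (e \<inter> f)"
    if e: "e \<in> E" and f: "f \<in> E" and ne: "e \<noteq> f" for e f
  proof
    fix u assume "u \<in> path_image (curve e) \<inter> path_image (curve f)"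
    then obtain s t where st: "s \<in> {0..1}" "t \<in> {0..1}" "u = curve e s" "u = curve f t"
      by (auto simp: path_image_def)
    then have "s \<in> {0, 1}" "t \<in> {0, 1}" using cross[OF e f st(1,2)] ne by auto
    then have "u \<in> pos ` e \<inter> pos ` f" using st ends e f by blast
    then show "u \<in> pos ` (e \<inter> f)"
      using inj_on_image_Int[OF inj edge(3)[OF e] edge(3)[OF f]] by simp
  qed
  have "{pathstart (curve e), pathfinish (curve e)} = pos ` e" if "e \<in> E" for e
    using ends[OF that] by (simp add: pathstart_def pathfinish_def)
  then show ?thesis
    unfolding drawable_on_def fst_conv snd_conv
    using inj posS arc curve(2) vertices meet by (intro exI[of _ pos] exI[of _ curve]) simp
qed

text \<open>The torus of revolution with radii \<open>2\<close> and \<open>1\<close>. Angles are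
  counted in full turns, so the period lattice is that of the integer points.\<close>

definition torus_point :: "real \<Rightarrow> real \<Rightarrow> real^3" where
  "torus_point a b = vector [(2 + cos (2 * pi * b)) * cos (2 * pi * a),
     (2 + cos (2 * pi * b)) * sin (2 * pi * a), sin (2 * pi * b)]"

definition torus :: "(real^3) set" where
  "torus = {torus_point a b |a b. True}"

lemma cos_sin_2pi_eq_iff:
  "cos (2 * pi * a) = cos (2 * pi * b) \<and> sin (2 * pi * a) = sin (2 * pi * b) \<longleftrightarrow> a - b \<in> \<int>"
proof -
  have "cos (2 * pi * a) = cos (2 * pi * b) \<and> sin (2 * pi * a) = sin (2 * pi * b) \<longleftrightarrow>
    (\<exists>k::int. 2 * pi * a = 2 * pi * b + 2 * pi * k)"
    using sin_cos_eq_iff by blast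
  also have "\<dots> \<longleftrightarrow> (\<exists>k::int. a - b = k)"
  proof (intro arg_cong[of _ _ Ex] ext)
    fix k :: int
    have "2 * pi * a = 2 * pi * b + 2 * pi * k \<longleftrightarrow> 2 * pi * (a - b) = 2 * pi * k"
      by (auto simp: algebra_simps)
    then show "2 * pi * a = 2 * pi * b + 2 * pi * k \<longleftrightarrow> a - b = k" by simp
  qed
  finally show ?thesis by (auto simp: Ints_def)
qed

lemma torus_point_eq_iff:
  "torus_point a b = torus_point a' b' \<longleftrightarrow> a - a' \<in> \<int> \<and> b - b' \<in> \<int>"
proof
  let ?r = "2 + cos (2 * pi * b)" and ?r' = "2 + cos (2 * pi * b')"
  have pos: "?r > 0" "?r' > 0" using cos_ge_minus_one[of "2 * pi * b"] cos_ge_minus_one[of "2 * pi * b'"] by linarith+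
  assume "torus_point a b = torus_point a' b'"
  then have eq: "?r * cos (2 * pi * a) = ?r' * cos (2 * pi * a')" "?r * sin (2 * pi * a) = ?r' * sin (2 * pi * a')"
    "sin (2 * pi * b) = sin (2 * pi * b')"
    unfolding torus_point_def by (metis vector_3)+
  have sq: "(r * cos x)\<^sup>2 + (r * sin x)\<^sup>2 = r\<^sup>2" for r x :: real
    by (simp add: power_mult_distrib flip: distrib_left)
  \<comment> \<open>The distance from the axis determines the cosine of the second angle, whose sine
    is the third coordinate.\<close>
  have "?r\<^sup>2 = ?r'\<^sup>2" using sq[of ?r "2 * pi * a"] sq[of ?r' "2 * pi * a'"] eq by simp
  then have r: "?r = ?r'" using pos by (simp add: power2_eq_iff)
  then have "cos (2 * pi * a) = cos (2 * pi * a')" "sin (2 * pi * a) = sin (2 * pi * a')"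
    using eq pos by auto
  then show "a - a' \<in> \<int> \<and> b - b' \<in> \<int>"
    using cos_sin_2pi_eq_iff r eq(3) by (metis add_left_cancel)
next
  assume "a - a' \<in> \<int> \<and> b - b' \<in> \<int>"
  then show "torus_point a b = torus_point a' b'"
    using cos_sin_2pi_eq_iff[of a a'] cos_sin_2pi_eq_iff[of b b'] by (simp add: torus_point_def)
qed

lemma continuous_on_torus_point:
  fixes f g :: "'a::t2_space \<Rightarrow> real"
  assumes "continuous_on X f" "continuous_on X g"
  shows "continuous_on X (\<lambda>x. torus_point (f x) (g x))"
proof -
  have "torus_point a b = (\<chi> i. if i = 1 then (2 + cos (2 * pi * b)) * cos (2 * pi * a)
      else if i = 2 then (2 + cos (2 * pi * b)) * sin (2 * pi * a) else sin (2 * pi * b))" for a b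
    by (simp add: torus_point_def vec_eq_iff forall_3)
  moreover have "continuous_on X (\<lambda>x. if i = 1 then (2 + cos (2 * pi * g x)) * cos (2 * pi * f x)
      else if i = 2 then (2 + cos (2 * pi * g x)) * sin (2 * pi * f x) else sin (2 * pi * g x))" for i :: 3
    using assms by (cases "i = 1"; cases "i = 2") (auto intro!: continuous_intros)
  ultimately show ?thesis by (simp add: continuous_on_vec_lambda)
qed

text \<open>The four-gon \<open>polygon 1\<close> has its corners on the axes. In the coordinates
  \<open>a\<close>, \<open>b\<close> it is the unit square centred at the origin, with sides
  parallel to the axes, and the gluing becomes translation by a unit vector.\<close>

definition square_point :: "real \<Rightarrow> real \<Rightarrow> complex" where
  "square_point a b = Complex (a - b) (a + b)"

lemma polygon_vertex_1:
  "polygon_vertex 1 0 = 1" "polygon_vertex 1 1 = \<i>" "polygon_vertex 1 2 = -1"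
  "polygon_vertex 1 3 = -\<i>" "polygon_vertex 1 4 = 1"
proof -
  have "2 * pi * real 3 / real (4 * 1) = pi + pi / 2" by simp
  then show "polygon_vertex 1 3 = -\<i>"
    unfolding polygon_vertex_def by (simp only: cis_mult[symmetric]) simp
qed (simp_all add: polygon_vertex_def complex_eq_iff)

lemma polygon_1: "polygon 1 = {square_point a b |a b. \<bar>a\<bar> \<le> 1/2 \<and> \<bar>b\<bar> \<le> 1/2}"
proof -
  have "{..<4 * 1 :: nat} = {0, 1, 2, 3}" by auto
  then have hull: "polygon 1 = convex hull {1, \<i>, -1, -\<i>}"
    unfolding polygon_def by (simp add: polygon_vertex_1[simplified])
  let ?P = "{z. \<bar>(Re z + Im z) / 2\<bar> \<le> 1/2 \<and> \<bar>(Im z - Re z) / 2\<bar> \<le> 1/2}"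
  have "convex ?P"
  proof -
    have "?P = {z. Re z + Im z \<le> 1} \<inter> {z. Re z + Im z \<ge> -1} \<inter> {z. Im z - Re z \<le> 1} \<inter> {z. Im z - Re z \<ge> -1}"
      by auto
    also have "convex \<dots>"
      using convex_halfspace_le[of "Complex 1 1"] convex_halfspace_le[of "Complex (-1) 1"]
        convex_halfspace_ge[of _ "Complex 1 1"] convex_halfspace_ge[of _ "Complex (-1) 1"]
      by (intro convex_Int) (simp_all add: inner_complex_def)
    finally show ?thesis .
  qed
  then have sub: "polygon 1 \<subseteq> ?P" unfolding hull by (intro hull_minimal) auto
  have sup: "square_point a b \<in> polygon 1" if ab: "\<bar>a\<bar> \<le> 1/2" "\<bar>b\<bar> \<le> 1/2" for a b
  proof -
    let ?H = "convex hull {1, \<i>, -1, -\<i>}"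
    have comb: "u *\<^sub>R x + v *\<^sub>R y \<in> ?H" if "x \<in> ?H" "y \<in> ?H" "u \<ge> 0" "v \<ge> 0" "u + v = 1" for x y u v
      using that convexD[OF convex_convex_hull] by blast
    have vert: "1 \<in> ?H" "\<i> \<in> ?H" "-1 \<in> ?H" "-\<i> \<in> ?H" by (auto intro: hull_inc)
    have "(1/2 + a) *\<^sub>R ((1/2 + b) *\<^sub>R \<i> + (1/2 - b) *\<^sub>R 1) + (1/2 - a) *\<^sub>R ((1/2 + b) *\<^sub>R (-1) + (1/2 - b) *\<^sub>R (-\<i>)) \<in> ?H"
      using ab by (intro comb vert) auto
    also have "(1/2 + a) *\<^sub>R ((1/2 + b) *\<^sub>R \<i> + (1/2 - b) *\<^sub>R 1) + (1/2 - a) *\<^sub>R ((1/2 + b) *\<^sub>R (-1) + (1/2 - b) *\<^sub>R (-\<i>)) = square_point a b"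
      by (simp add: complex_eq_iff square_point_def algebra_simps)
    finally show ?thesis unfolding hull .
  qed
  show ?thesis
  proof
    show "polygon 1 \<subseteq> {square_point a b |a b. \<bar>a\<bar> \<le> 1/2 \<and> \<bar>b\<bar> \<le> 1/2}"
    proof
      fix z assume "z \<in> polygon 1"
      moreover have "z = square_point ((Re z + Im z) / 2) ((Im z - Re z) / 2)"
        by (simp add: complex_eq_iff square_point_def field_simps)
      ultimately show "z \<in> {square_point a b |a b. \<bar>a\<bar> \<le> 1/2 \<and> \<bar>b\<bar> \<le> 1/2}" using sub by blast
    qed
  qed (use sup in blast)
qed

lemma side_pairing_1:
  "side_pairing 1 z w \<longleftrightarrow> (\<exists>c. \<bar>c\<bar> \<le> 1/2 \<and>
     (z = square_point (1/2) c \<and> w = square_point (-1/2) c \<or> z = square_point c (1/2) \<and> w = square_point c (-1/2)))"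
proof -
  have 0: "polygon_side 1 0 t = square_point (1/2) (t - 1/2)" "polygon_side 1 2 (1 - t) = square_point (-1/2) (t - 1/2)"
    and 1: "polygon_side 1 1 t = square_point (1/2 - t) (1/2)" "polygon_side 1 3 (1 - t) = square_point (1/2 - t) (-1/2)" for t
    using polygon_vertex_1
    by (simp_all add: polygon_side_def linepath_def square_point_def complex_eq_iff eval_nat_numeral algebra_simps)
  have "side_pairing 1 z w \<longleftrightarrow> (\<exists>t\<in>{0..1}. z = square_point (1/2) (t - 1/2) \<and> w = square_point (-1/2) (t - 1/2)) \<or>
    (\<exists>t\<in>{0..1}. z = square_point (1/2 - t) (1/2) \<and> w = square_point (1/2 - t) (-1/2))"
    unfolding side_pairing_def by (simp add: 0[simplified] 1[simplified] numeral_3_eq_3[symmetric] numeral_2_eq_2[symmetric])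
  also have "\<dots> \<longleftrightarrow> (\<exists>c. \<bar>c\<bar> \<le> 1/2 \<and> (z = square_point (1/2) c \<and> w = square_point (-1/2) c)) \<or>
     (\<exists>c. \<bar>c\<bar> \<le> 1/2 \<and> (z = square_point c (1/2) \<and> w = square_point c (-1/2)))"
  proof -
    have A: "(\<exists>t\<in>{0..1}. P (t - 1/2)) \<longleftrightarrow> (\<exists>c. \<bar>c\<bar> \<le> 1/2 \<and> P c)" for P :: "real \<Rightarrow> bool"
    proof safe
      fix c :: real assume "\<bar>c\<bar> \<le> 1/2" "P c" then show "\<exists>t\<in>{0..1}. P (t - 1/2)"
        by (intro bexI[of _ "c + 1/2"]) auto
    next
      fix t :: real assume "t \<in> {0..1}" "P (t - 1/2)"
      moreover from this have "\<bar>t - 1/2\<bar> \<le> 1/2" by (simp only: abs_le_iff) auto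
      ultimately show "\<exists>c. \<bar>c\<bar> \<le> 1/2 \<and> P c" by blast
    qed
    have B: "(\<exists>t\<in>{0..1}. P (1/2 - t)) \<longleftrightarrow> (\<exists>c. \<bar>c\<bar> \<le> 1/2 \<and> P c)" for P :: "real \<Rightarrow> bool"
    proof safe
      fix c :: real assume "\<bar>c\<bar> \<le> 1/2" "P c" then show "\<exists>t\<in>{0..1}. P (1/2 - t)"
        by (intro bexI[of _ "1/2 - c"]) auto
    next
      fix t :: real assume "t \<in> {0..1}" "P (1/2 - t)"
      moreover from this have "\<bar>1/2 - t\<bar> \<le> 1/2" by (simp only: abs_le_iff) auto
      ultimately show "\<exists>c. \<bar>c\<bar> \<le> 1/2 \<and> P c" by blast
    qed
    show ?thesis
      using A[of "\<lambda>c. z = square_point (1/2) c \<and> w = square_point (-1/2) c"]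
        B[of "\<lambda>c. z = square_point c (1/2) \<and> w = square_point c (-1/2)"] by simp
  qed
  finally show ?thesis by blast
qed

lemma closed_orientable_surface_torus: "closed_orientable_surface 1 torus"
proof -
  define q where "q z = torus_point ((Re z + Im z) / 2) ((Im z - Re z) / 2)" for z
  have q: "q (square_point a b) = torus_point a b" for a b
    by (simp add: q_def square_point_def)
  have cont: "continuous_on X q" for X
    unfolding q_def by (intro continuous_on_torus_point continuous_intros) auto
  have img: "q ` polygon 1 = torus"
  proof
    show "q ` polygon 1 \<subseteq> torus" by (auto simp: polygon_1[simplified] q) (auto simp: torus_def)
    show "torus \<subseteq> q ` polygon 1"
    proof
      fix u assume "u \<in> torus"
      then obtain a b where u: "u = torus_point a b" by (auto simp: torus_def)
      define a' b' where "a' = a - of_int (round a)" and "b' = b - of_int (round b)"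
      have "u = torus_point a' b'" by (simp add: u torus_point_eq_iff a'_def b'_def)
      moreover have "\<bar>a'\<bar> \<le> 1/2" "\<bar>b'\<bar> \<le> 1/2"
        unfolding a'_def b'_def by (metis abs_minus_commute of_int_round_abs_le)+
      ultimately show "u \<in> q ` polygon 1" by (auto simp: polygon_1[simplified] q[symmetric])
    qed
  qed
  have "compact (polygon 1)"
    unfolding polygon_def by (intro compact_convex_hull finite_imp_compact) auto
  \<comment> \<open>A continuous surjection from a compact space onto a Hausdorff space is a
    quotient map.\<close>
  then have "quotient_map (top_of_set (polygon 1)) (top_of_set torus) q"
    using cont img
    by (intro continuous_imp_quotient_map)
      (auto simp: compact_space_subtopology Hausdorff_space_subtopology continuous_map_in_subtopology)
  moreover have "q z = q w \<longleftrightarrow> equivclp (side_pairing 1) z w" if zw: "z \<in> polygon 1" "w \<in> polygon 1" for z w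
  proof
    assume "equivclp (side_pairing 1) z w"
    then show "q z = q w"
    proof (induction rule: equivclp_induct)
      case (step y z)
      have "q y = q z" if "side_pairing 1 y z" for y z
        using that unfolding side_pairing_1 by (auto simp: q torus_point_eq_iff)
      with step show ?case by metis
    qed simp
  next
    assume eq: "q z = q w"
    obtain a b where z: "z = square_point a b" "\<bar>a\<bar> \<le> 1/2" "\<bar>b\<bar> \<le> 1/2" using zw(1) unfolding polygon_1 by blast
    obtain a' b' where w: "w = square_point a' b'" "\<bar>a'\<bar> \<le> 1/2" "\<bar>b'\<bar> \<le> 1/2" using zw(2) unfolding polygon_1 by blast
    have ints: "a - a' \<in> \<int>" "b - b' \<in> \<int>" using eq by (auto simp: z w q torus_point_eq_iff)
    have half: "x = y \<or> x = 1/2 \<and> y = -1/2 \<or> x = -1/2 \<and> y = 1/2"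
      if xy: "x - y \<in> \<int>" "\<bar>x\<bar> \<le> 1/2" "\<bar>y\<bar> \<le> 1/2" for x y :: real
    proof -
      obtain k :: int where k: "x - y = of_int k" using xy(1) by (auto simp: Ints_def)
      then have "\<bar>of_int k\<bar> \<le> (1::real)" using xy(2,3) by linarith
      then have "k = 0 \<or> k = 1 \<or> k = -1" by linarith
      then show ?thesis using k xy(2,3) by auto
    qed
    have pair: "equivclp (side_pairing 1) (square_point (1/2) c) (square_point (-1/2) c)"
      "equivclp (side_pairing 1) (square_point c (1/2)) (square_point c (-1/2))" if "\<bar>c\<bar> \<le> 1/2" for c
      using that by (auto intro!: r_into_equivclp simp only: side_pairing_1)
    \<comment> \<open>The coordinates are changed one at a time, each by at most one pairing;
      opposite corners need both.\<close>
    have "equivclp (side_pairing 1) (square_point a b) (square_point a' b)"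
      using half[OF ints(1) z(2) w(2)] pair(1)[OF z(3)] equivclp_sym[OF pair(1)[OF z(3)]]
      by (elim disjE conjE) (simp_all only: equivclp_refl)
    also have "equivclp (side_pairing 1) (square_point a' b) (square_point a' b')"
      using half[OF ints(2) z(3) w(3)] pair(2)[OF w(2)] equivclp_sym[OF pair(2)[OF w(2)]]
      by (elim disjE conjE) (simp_all only: equivclp_refl)
    finally show "equivclp (side_pairing 1) z w" by (simp add: z w)
  qed
  ultimately show ?thesis unfolding closed_orientable_surface_def by auto
qed

section \<open>Haar graphs of cyclic groups and the hexagonal tiling of the torus\<close>

text \<open>\<open>R\<close> and \<open>F\<close> are periodic on all integers rather than indexed
  by residues, so index arithmetic stays in \<open>int\<close> and only equality of vertices is
  modular.\<close>

locale haar_graph =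
  fixes R F :: "int \<Rightarrow> 'v" and n :: int
  assumes n_pos: "n > 0"
    and R_eq_iff: "R x = R y \<longleftrightarrow> [x = y] (mod n)"
    and F_eq_iff: "F x = F y \<longleftrightarrow> [x = y] (mod n)"
    and R_neq_F [simp]: "R x \<noteq> F y"
begin

lemma F_neq_R [simp]: "F y \<noteq> R x"
  using R_neq_F[of x y] by metis

definition vertices :: "'v set" where
  "vertices = range R \<union> range F"

definition edges :: "int set \<Rightarrow> 'v set set" where
  "edges D = {{R x, F (x + s)} |x s. s \<in> D}"

lemma edges_subset: "e \<in> edges D \<Longrightarrow> e \<subseteq> vertices"
  by (auto simp: edges_def vertices_def)

lemma vertices_covered: "D \<noteq> {} \<Longrightarrow> vertices \<subseteq> \<Union> (edges D)"
proof
  fix v assume "D \<noteq> {}" "v \<in> vertices"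
  then obtain s x where s: "s \<in> D" and "v = R x \<or> v = F x" by (auto simp: vertices_def)
  then have "v \<in> {R x, F (x + s)} \<or> v \<in> {R (x - s), F ((x - s) + s)}" by auto
  then show "v \<in> \<Union> (edges D)" using s unfolding edges_def by blast
qed

end

section \<open>Plane lattices of index \<open>n\<close> and their tori\<close>

lemma gcd_3_combination:
  fixes p q n x :: int
  assumes "gcd p (gcd q n) = 1"
  obtains a b c where "x = a * p + b * q + c * n"
proof -
  obtain u v where uv: "u * p + v * gcd q n = gcd p (gcd q n)" using bezout_int by blast
  obtain u' v' where uv': "u' * q + v' * n = gcd q n" using bezout_int by blast
  have "x * (u * p + v * (u' * q + v' * n)) = x" by (simp only: uv uv' assms mult_1_right)
  then have "x = (x * u) * p + (x * v * u') * q + (x * v * v') * n" by (simp add: algebra_simps)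
  then show thesis by (rule that)
qed

text \<open>The Hermite normal form of the lattice of all \<open>(a, b)\<close> with
  \<open>n dvd a * p + b * q\<close>: it has the basis \<open>(M, 0)\<close>,
  \<open>(-t, d)\<close>, where \<open>d = gcd p n\<close> and \<open>d * M = n\<close>.\<close>

lemma sublattice_basis:
  fixes n p q :: int
  assumes "n > 0" "gcd p (gcd q n) = 1"
  obtains d M t :: int where "d > 0" "M > 0"
    "\<And>a b :: int. n dvd a * p + b * q \<longleftrightarrow> d dvd b \<and> M dvd a + t * (b div d)"
proof -
  define d M where "d = gcd p n" and "M = n div d"
  have d: "d > 0" using assms(1) by (simp add: d_def)
  have n: "n = d * M" by (simp add: d_def M_def)
  then have M: "M > 0" using assms(1) d by (simp add: zero_less_mult_iff)
  obtain p' where p: "p = d * p'" unfolding d_def by (meson dvdE gcd_dvd1)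
  have "gcd d M * 1 = gcd d M" by simp
  have cop: "coprime p' M"
  proof -
    have "d * gcd p' M = d * 1" using n p d_def d by (metis abs_of_pos gcd_mult_distrib_int mult.right_neutral)
    then show ?thesis using d by (simp add: coprime_iff_gcd_eq_1)
  qed
  have copdq: "coprime d q"
    using assms(2) unfolding d_def coprime_iff_gcd_eq_1 by (metis gcd.assoc gcd.commute)
  \<comment> \<open>For \<open>b = d * k\<close>, dividing by \<open>d\<close> leaves
    \<open>M dvd a * p' + k * q\<close>; multiplying by the inverse \<open>x\<close> of
    \<open>p'\<close> gives \<open>t = x * q\<close>.\<close>
  obtain x where x: "[p' * x = 1] (mod M)" using cong_solve_coprime_int[OF cop] by blast
  show thesis
  proof
    show "d > 0" "M > 0" by fact+
    fix a b :: int
    show "n dvd a * p + b * q \<longleftrightarrow> d dvd b \<and> M dvd a + (x * q) * (b div d)"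
    proof (cases "d dvd b")
      case True
      then obtain k where k: "b = d * k" by blast
      have "n dvd a * p + b * q \<longleftrightarrow> d * M dvd d * (a * p' + k * q)" by (simp add: n p k algebra_simps)
      also have "\<dots> \<longleftrightarrow> M dvd a * p' + k * q" using d by simp
      also have "\<dots> \<longleftrightarrow> M dvd p' * (a + x * q * k)"
      proof -
        have "[p' * x * (q * k) = 1 * (q * k)] (mod M)" by (intro cong_mult x cong_refl)
        then have "[a * p' + p' * x * (q * k) = a * p' + 1 * (q * k)] (mod M)" by (intro cong_add cong_refl)
        then show ?thesis using cong_dvd_iff by (fastforce simp: algebra_simps)
      qed
      also have "\<dots> \<longleftrightarrow> M dvd a + x * q * k"
        using cop by (simp add: coprime_dvd_mult_right_iff coprime_commute)
      finally show ?thesis using True k d by simp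
    next
      case False
      have "d dvd b" if "n dvd a * p + b * q"
      proof -
        have "d dvd a * p + b * q" using that n by (metis dvd_mult_left)
        then have "d dvd b * q" using p by (simp add: dvd_add_right_iff)
        then show ?thesis using copdq by (simp add: coprime_dvd_mult_left_iff)
      qed
      then show ?thesis using False by blast
    qed
  qed
qed

lemma torus_lattice_map:
  fixes n p q :: int
  assumes "n > 0" "gcd p (gcd q n) = 1"
  shows "\<exists>T :: real \<Rightarrow> real \<Rightarrow> real^3. (\<forall>u v. T u v \<in> torus) \<and>
    (\<forall>(f :: real \<Rightarrow> real) g X. continuous_on X f \<longrightarrow> continuous_on X g \<longrightarrow> continuous_on X (\<lambda>x. T (f x) (g x))) \<and>
    (\<forall>u v u' v'. T u v = T u' v' \<longleftrightarrow>
      (\<exists>i j. u - u' = real_of_int i \<and> v - v' = real_of_int j \<and> n dvd i * p + j * q))"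
proof -
  obtain d M t :: int where dM: "d > 0" "M > 0"
    and dvd: "\<And>a b :: int. n dvd a * p + b * q \<longleftrightarrow> d dvd b \<and> M dvd a + t * (b div d)"
    using sublattice_basis[OF assms] by metis
  \<comment> \<open>The coordinates of \<open>(u, v)\<close> in the basis \<open>(M, 0)\<close>,
    \<open>(-t, d)\<close>, so that the lattice becomes the integer lattice of
    \<open>torus_point\<close>.\<close>
  define T where "T u v = torus_point ((u + t * (v / d)) / M) (v / d)" for u v :: real
  have T_in: "T u v \<in> torus" for u v by (auto simp: T_def torus_def)
  have T_cont: "continuous_on X (\<lambda>x. T (f x) (g x))" if "continuous_on X f" "continuous_on X g" for f g :: "real \<Rightarrow> real" and X
      unfolding T_def using that dM by (intro continuous_on_torus_point continuous_intros) auto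
  have T_eq: "T u v = T u' v' \<longleftrightarrow> (\<exists>i j. u - u' = real_of_int i \<and> v - v' = real_of_int j \<and> n dvd i * p + j * q)" for u v u' v' :: real
    proof -
      have "T u v = T u' v' \<longleftrightarrow> (\<exists>m k. (u - u' + t * ((v - v') / d)) / M = real_of_int m \<and> (v - v') / d = real_of_int k)"
        by (auto simp: T_def torus_point_eq_iff Ints_def diff_divide_distrib right_diff_distrib add_divide_distrib algebra_simps)
      also have "\<dots> \<longleftrightarrow> (\<exists>m k. u - u' = real_of_int M * real_of_int m - real_of_int t * real_of_int k \<and> v - v' = real_of_int d * real_of_int k)"
      proof (intro arg_cong[of _ _ Ex] ext)
        fix m k
        have "(v - v') / d = real_of_int k \<longleftrightarrow> v - v' = real_of_int d * real_of_int k"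
          using dM by (auto simp: field_simps)
        moreover have "(u - u' + t * real_of_int k) / M = real_of_int m \<longleftrightarrow>
            u - u' = real_of_int M * real_of_int m - real_of_int t * real_of_int k"
          using dM by (auto simp: field_simps)
        ultimately show "((u - u' + t * ((v - v') / d)) / M = real_of_int m \<and> (v - v') / d = real_of_int k) =
            (u - u' = real_of_int M * real_of_int m - real_of_int t * real_of_int k \<and> v - v' = real_of_int d * real_of_int k)"
          by metis
      qed
      also have "\<dots> \<longleftrightarrow> (\<exists>i j. u - u' = real_of_int i \<and> v - v' = real_of_int j \<and> n dvd i * p + j * q)"
      proof
        assume "\<exists>m k. u - u' = real_of_int M * real_of_int m - real_of_int t * real_of_int k \<and> v - v' = real_of_int d * real_of_int k"
        then obtain m k where mk: "u - u' = real_of_int M * real_of_int m - real_of_int t * real_of_int k" "v - v' = real_of_int d * real_of_int k" by blast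
        show "\<exists>i j. u - u' = real_of_int i \<and> v - v' = real_of_int j \<and> n dvd i * p + j * q"
          by (rule exI[of _ "M * m - t * k"], rule exI[of _ "d * k"]) (use mk dM in \<open>simp add: dvd\<close>)
      next
        assume "\<exists>i j. u - u' = real_of_int i \<and> v - v' = real_of_int j \<and> n dvd i * p + j * q"
        then obtain i j where ij: "u - u' = real_of_int i" "v - v' = real_of_int j" "d dvd j" "M dvd i + t * (j div d)"
          by (auto simp: dvd)
        from ij(3) obtain k where "j = d * k" by blast
        moreover from ij(4) obtain m where "i + t * (j div d) = M * m" by blast
        ultimately have "j = d * k" "i = M * m - t * k" using dM by auto
        then show "\<exists>m k. u - u' = real_of_int M * real_of_int m - real_of_int t * real_of_int k \<and> v - v' = real_of_int d * real_of_int k"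
          using ij by (intro exI[of _ m] exI[of _ k]) simp
      qed
      finally show ?thesis .
    qed
  show ?thesis by (intro exI[of _ T] conjI allI impI T_in T_cont T_eq)
qed

text \<open>In the hexagonal tiling, the centre \<open>(-1/3, -1/3)\<close> of a triangle of the standard lattice is
  joined to its corners \<open>(-i, -j)\<close>.\<close>

lemma hexagonal_edges_cross:
  fixes s t :: real and i j i' j' a b :: int
  assumes "(i, j) \<in> {(0, 0), (1, 0), (0, 1)}" "(i', j') \<in> {(0, 0), (1, 0), (0, 1)}"
    and st: "0 \<le> s" "s \<le> 1" "0 \<le> t" "t \<le> 1"
    and a: "s * (1/3 - i) - t * (1/3 - i') = a" and b: "s * (1/3 - j) - t * (1/3 - j') = b"
  shows "i = i' \<and> j = j' \<and> s = t \<and> a = 0 \<and> b = 0 \<or> s \<in> {0, 1} \<and> t \<in> {0, 1}"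
proof -
  \<comment> \<open>Each segment is so short that only neighbouring translates can interfere, which
    leaves finitely many linear systems in \<open>s\<close> and \<open>t\<close>.\<close>
  have "\<bar>real_of_int a\<bar> < 2" "\<bar>real_of_int b\<bar> < 2"
    using assms(1,2) st unfolding a[symmetric] b[symmetric] by (auto simp: abs_less_iff)
  then have ab: "a = -1 \<or> a = 0 \<or> a = 1" "b = -1 \<or> b = 0 \<or> b = 1" by linarith+
  define x y where "x = real_of_int a" and "y = real_of_int b"
  have xy: "x = -1 \<or> x = 0 \<or> x = 1" "y = -1 \<or> y = 0 \<or> y = 1"
    using ab by (auto simp: x_def y_def)
  have eq: "s * (1/3 - i) - t * (1/3 - i') = x" "s * (1/3 - j) - t * (1/3 - j') = y"
    using a b by (simp_all add: x_def y_def)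
  have ij: "i = 0 \<and> j = 0 \<or> i = 1 \<and> j = 0 \<or> i = 0 \<and> j = 1"
    "i' = 0 \<and> j' = 0 \<or> i' = 1 \<and> j' = 0 \<or> i' = 0 \<and> j' = 1"
    using assms(1,2) by auto
  have "i = i' \<and> j = j' \<and> s = t \<and> x = 0 \<and> y = 0 \<or> s = 0 \<and> t = 0 \<or> s = 1 \<and> t = 1"
    using ij xy by (elim disjE conjE) (use eq st in \<open>simp; argo\<close>)+
  then show ?thesis by (auto simp: x_def y_def)
qed

context haar_graph
begin

text \<open>By coprimality every index is congruent to some \<open>a * p + b * q\<close>, and
  \<open>(a, b)\<close> is unique up to the lattice of \<open>sublattice_basis\<close>. The vertex
  \<open>R\<close> of this index goes to \<open>(a, b)\<close>, the vertex \<open>F\<close> to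
  \<open>(a - 1/3, b - 1/3)\<close>, and the differences \<open>0\<close>, \<open>p\<close>,
  \<open>q\<close> become the three segments from a centre to the corners of its triangle.\<close>

theorem drawable_on_torus:
  assumes "gcd p (gcd q n) = 1"
  shows "drawable_on (vertices, edges {0, p, q}) torus"
proof -
  obtain T :: "real \<Rightarrow> real \<Rightarrow> real^3" where T: "\<And>u v. T u v \<in> torus"
    and "\<forall>(f :: real \<Rightarrow> real) g X. continuous_on X f \<longrightarrow> continuous_on X g \<longrightarrow> continuous_on X (\<lambda>x. T (f x) (g x))"
    and T_eq: "\<And>u v u' v'. T u v = T u' v' \<longleftrightarrow> (\<exists>i j. u - u' = real_of_int i \<and> v - v' = real_of_int j \<and> n dvd i * p + j * q)"
    using torus_lattice_map[OF n_pos assms] by blast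
  then have contT: "\<And>(f :: real \<Rightarrow> real) g X. continuous_on X f \<Longrightarrow> continuous_on X g \<Longrightarrow> continuous_on X (\<lambda>x. T (f x) (g x))"
    by blast
  define lab where "lab a b = a * p + b * q" for a b :: int
  have lab: "\<exists>a b. [x = lab a b] (mod n)" for x
  proof -
    obtain a b c where "x = a * p + b * q + c * n" using gcd_3_combination[OF assms] .
    then have "[x = lab a b] (mod n)" by (simp add: lab_def cong_iff_dvd_diff)
    then show ?thesis by blast
  qed
  have cong_lab: "[lab a b = lab a' b'] (mod n) \<longleftrightarrow> n dvd (a - a') * p + (b - b') * q" for a b a' b'
    by (simp add: cong_iff_dvd_diff lab_def algebra_simps)
  have "\<forall>v\<in>vertices. \<exists>x y. (\<exists>a b. v = R (lab a b) \<and> x = real_of_int a \<and> y = real_of_int b) \<or>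
    (\<exists>a b. v = F (lab a b) \<and> x = a - 1/3 \<and> y = b - 1/3)"
  proof
    fix v assume "v \<in> vertices"
    then obtain x where "v = R x \<or> v = F x" by (auto simp: vertices_def)
    moreover obtain a b where "[x = lab a b] (mod n)" using lab by blast
    ultimately have "v = R (lab a b) \<or> v = F (lab a b)" using R_eq_iff F_eq_iff by blast
    then show "\<exists>x y. (\<exists>a b. v = R (lab a b) \<and> x = real_of_int a \<and> y = real_of_int b) \<or>
      (\<exists>a b. v = F (lab a b) \<and> x = a - 1/3 \<and> y = b - 1/3)" by blast
  qed
  then obtain X Y :: "'v \<Rightarrow> real" where
    XY: "\<And>v. v \<in> vertices \<Longrightarrow> (\<exists>a b. v = R (lab a b) \<and> X v = real_of_int a \<and> Y v = real_of_int b) \<or>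
    (\<exists>a b. v = F (lab a b) \<and> X v = a - 1/3 \<and> Y v = b - 1/3)"
    by metis
  define pos where "pos v = T (X v) (Y v)" for v
  \<comment> \<open>The coordinates \<open>X\<close>, \<open>Y\<close> were chosen arbitrarily among
    the representatives; on the torus the choice disappears.\<close>
  have posR: "pos (R (lab a b)) = T a b" for a b
  proof -
    have "R (lab a b) \<in> vertices" by (simp add: vertices_def)
    from XY[OF this] obtain a' b' where "R (lab a b) = R (lab a' b')" "X (R (lab a b)) = real_of_int a'"
      "Y (R (lab a b)) = real_of_int b'" by auto
    then show ?thesis using R_eq_iff cong_lab cong_sym[of "lab a b" "lab a' b'" n] unfolding pos_def T_eq
      by (intro exI[of _ "a' - a"] exI[of _ "b' - b"]) auto
  qed
  have posF: "pos (F (lab a b)) = T (a - 1/3) (b - 1/3)" for a b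
  proof -
    have "F (lab a b) \<in> vertices" by (simp add: vertices_def)
    from XY[OF this] obtain a' b' where "F (lab a b) = F (lab a' b')" "X (F (lab a b)) = real_of_int a' - 1/3"
      "Y (F (lab a b)) = real_of_int b' - 1/3" by auto
    then show ?thesis using F_eq_iff cong_lab cong_sym[of "lab a b" "lab a' b'" n] unfolding pos_def T_eq
      by (intro exI[of _ "a' - a"] exI[of _ "b' - b"]) auto
  qed
  have vertex_cases: "(\<exists>a b. v = R (lab a b)) \<or> (\<exists>a b. v = F (lab a b))" if "v \<in> vertices" for v
    using XY[OF that] by blast
  have T_int: "T (real_of_int a) (real_of_int b) = T (real_of_int a') (real_of_int b') \<longleftrightarrow> [lab a b = lab a' b'] (mod n)" for a b a' b'
    unfolding T_eq cong_lab by (metis of_int_diff of_int_eq_iff)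
  have T_third: "T (real_of_int a - 1/3) (real_of_int b - 1/3) = T (real_of_int a' - 1/3) (real_of_int b' - 1/3) \<longleftrightarrow> [lab a b = lab a' b'] (mod n)" for a b a' b'
    unfolding T_eq cong_lab by (simp, metis of_int_diff of_int_eq_iff)
  have third: "T (real_of_int a) (real_of_int b) \<noteq> T (real_of_int a' - 1/3) (real_of_int b' - 1/3)" for a b a' b'
  proof
    assume "T (real_of_int a) (real_of_int b) = T (real_of_int a' - 1/3) (real_of_int b' - 1/3)"
    then obtain i :: int where "real_of_int a - (real_of_int a' - 1/3) = i" unfolding T_eq by blast
    then have "real_of_int (3 * (i - a + a')) = 1" by simp
    then have "3 * (i - a + a') = 1" by (metis of_int_1 of_int_eq_iff)
    then show False by presburger
  qed
  have inj: "inj_on pos vertices"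
  proof (rule inj_onI)
    fix v w assume "v \<in> vertices" "w \<in> vertices" and eq: "pos v = pos w"
    then show "v = w"
      using vertex_cases[of v] vertex_cases[of w] third third[symmetric]
      by (auto simp: posR posF T_int T_third R_eq_iff F_eq_iff)
  qed
  let ?K = "{(0, 0), (1, 0), (0, 1)} :: (int \<times> int) set"
  have "\<exists>a b i j. (i, j) \<in> ?K \<and> e = {F (lab a b), R (lab (a - i) (b - j))}" if e: "e \<in> edges {0, p, q}" for e
  proof -
    obtain x s where e: "e = {R x, F (x + s)}" and s: "s \<in> {0, p, q}" using e by (auto simp: edges_def)
    obtain i j where ij: "(i, j) \<in> ?K" "s = lab i j" using s unfolding lab_def by force
    obtain a b where ab: "[x + s = lab a b] (mod n)" using lab by blast
    then have "[x + s - s = lab a b - s] (mod n)" by (intro cong_diff cong_refl)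
    then have "[x = lab (a - i) (b - j)] (mod n)" by (simp add: ij lab_def algebra_simps)
    then have "R x = R (lab (a - i) (b - j))" "F (x + s) = F (lab a b)"
      using ab R_eq_iff F_eq_iff by blast+
    then have "e = {F (lab a b), R (lab (a - i) (b - j))}" using e by (simp add: insert_commute)
    then show ?thesis using ij by blast
  qed
  then obtain a b i j where rep: "\<And>e. e \<in> edges {0, p, q} \<Longrightarrow> (i e, j e) \<in> ?K"
    "\<And>e. e \<in> edges {0, p, q} \<Longrightarrow> e = {F (lab (a e) (b e)), R (lab (a e - i e) (b e - j e))}"
    by metis
  define curve where "curve e t = T (a e - 1/3 + t * (1/3 - i e)) (b e - 1/3 + t * (1/3 - j e))" for e and t :: real
  show ?thesis
  proof (rule drawable_onI[where pos = pos and curve = curve and src = "\<lambda>e. F (lab (a e) (b e))"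
        and tgt = "\<lambda>e. R (lab (a e - i e) (b e - j e))"])
    show "vertices \<subseteq> \<Union> (edges {0, p, q})" by (rule vertices_covered) simp
    show "path (curve e)" for e unfolding path_def curve_def by (intro contT continuous_intros)
    show "curve e 0 = pos (F (lab (a e) (b e)))" for e by (simp add: curve_def posF)
    show "curve e 1 = pos (R (lab (a e - i e) (b e - j e)))" for e by (simp add: curve_def posR)
    show "pos ` vertices \<subseteq> torus" "path_image (curve e) \<subseteq> torus" for e
      using T by (auto simp: pos_def curve_def path_image_def)
    fix e f s t
    assume ef: "e \<in> edges {0, p, q}" "f \<in> edges {0, p, q}" and st: "s \<in> {0..1}" "t \<in> {0..1}" and "curve e s = curve f t"
    then obtain k l where kl: "a e - 1/3 + s * (1/3 - i e) - (a f - 1/3 + t * (1/3 - i f)) = real_of_int k"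
      "b e - 1/3 + s * (1/3 - j e) - (b f - 1/3 + t * (1/3 - j f)) = real_of_int l" "n dvd k * p + l * q"
      unfolding curve_def T_eq by blast
    have "s * (1/3 - i e) - t * (1/3 - i f) = real_of_int (k - a e + a f)"
      "s * (1/3 - j e) - t * (1/3 - j f) = real_of_int (l - b e + b f)" using kl by (simp_all add: algebra_simps)
    then have "i e = i f \<and> j e = j f \<and> s = t \<and> k - a e + a f = 0 \<and> l - b e + b f = 0 \<or> s \<in> {0, 1} \<and> t \<in> {0, 1}"
      using rep(1)[OF ef(1)] rep(1)[OF ef(2)] st by (intro hexagonal_edges_cross) auto
    then show "e = f \<and> s = t \<or> s \<in> {0, 1} \<and> t \<in> {0, 1}"
    proof (elim disjE conjE)
      assume eq: "i e = i f" "j e = j f" "s = t" "k - a e + a f = 0" "l - b e + b f = 0"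
      have k: "k = a e - a f" and l: "l = b e - b f" using eq by auto
      then have "[lab (a e) (b e) = lab (a f) (b f)] (mod n)"
        "[lab (a e - i e) (b e - j e) = lab (a f - i f) (b f - j f)] (mod n)"
        using kl(3) eq(1,2) unfolding cong_lab k l by simp_all
      then have "e = f" using rep(2)[OF ef(1)] rep(2)[OF ef(2)] R_eq_iff F_eq_iff by metis
      then show ?thesis using eq by blast
    qed blast
  qed (use inj rep edges_subset in auto)
qed

end

section \<open>Prisms on the sphere\<close>

definition sphere_point :: "real \<Rightarrow> real \<Rightarrow> real^3" where
  "sphere_point u v = vector [cos v * cos (2 * pi * u), cos v * sin (2 * pi * u), sin v]"

lemma sphere_point_in: "sphere_point u v \<in> sphere 0 1"
proof -
  have "(cos v * cos x)\<^sup>2 + (cos v * sin x)\<^sup>2 + (sin v)\<^sup>2 = 1" for x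
  proof -
    have "(cos v * cos x)\<^sup>2 + (cos v * sin x)\<^sup>2 = (cos v)\<^sup>2"
      by (simp add: power_mult_distrib flip: distrib_left)
    then show ?thesis by simp
  qed
  then show ?thesis
    by (simp add: sphere_point_def norm_eq_sqrt_inner inner_vec_def sum_3 power2_eq_square)
qed

text \<open>Latitudes between \<open>0\<close> and \<open>1\<close> radian stay below the pole,
  where longitudes would collapse.\<close>

lemma sphere_point_eq_iff:
  assumes v: "0 \<le> v" "v \<le> 1" and v': "0 \<le> v'" "v' \<le> 1"
  shows "sphere_point u v = sphere_point u' v' \<longleftrightarrow> u - u' \<in> \<int> \<and> v = v'"
proof
  assume "sphere_point u v = sphere_point u' v'"
  then have eq: "cos v * cos (2 * pi * u) = cos v' * cos (2 * pi * u')"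
    "cos v * sin (2 * pi * u) = cos v' * sin (2 * pi * u')" "sin v = sin v'"
    by (simp_all add: sphere_point_def vec_eq_iff forall_3)
  have bounds: "- (pi / 2) \<le> v" "v \<le> pi / 2" "- (pi / 2) \<le> v'" "v' \<le> pi / 2"
    "- (pi / 2) < v" "v < pi / 2"
    using v v' pi_gt3 by linarith+
  have "v = v'" by (rule sin_inj_pi[OF bounds(1-4) eq(3)])
  moreover have "cos v > 0" by (rule cos_gt_zero_pi[OF bounds(5,6)])
  ultimately show "u - u' \<in> \<int> \<and> v = v'" using eq cos_sin_2pi_eq_iff[of u u'] by simp
next
  assume "u - u' \<in> \<int> \<and> v = v'"
  then show "sphere_point u v = sphere_point u' v'"
    using cos_sin_2pi_eq_iff[of u u'] by (simp add: sphere_point_def)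
qed

lemma continuous_on_sphere_point:
  fixes f g :: "'a::t2_space \<Rightarrow> real"
  assumes "continuous_on X f" "continuous_on X g"
  shows "continuous_on X (\<lambda>x. sphere_point (f x) (g x))"
proof -
  have "sphere_point a b = (\<chi> i. if i = 1 then cos b * cos (2 * pi * a)
      else if i = 2 then cos b * sin (2 * pi * a) else sin b)" for a b
    by (simp add: sphere_point_def vec_eq_iff forall_3)
  moreover have "continuous_on X (\<lambda>x. if i = 1 then cos (g x) * cos (2 * pi * f x)
      else if i = 2 then cos (g x) * sin (2 * pi * f x) else sin (g x))" for i :: 3
    using assms by (cases "i = 1"; cases "i = 2") (auto intro!: continuous_intros)
  ultimately show ?thesis by (simp add: continuous_on_vec_lambda)
qed

text \<open>Edges are unit segments in the strip of height \<open>1\<close>: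
  \<open>(i, j) = (1, 0)\<close> is a step along the cycle at height \<open>r\<close>, and
  \<open>(0, 1)\<close> is a rung starting at height \<open>0\<close>. The integer \<open>a\<close>
  absorbs the difference of the longitudes of the starting points, taken modulo
  \<open>n\<close>.\<close>

lemma prism_edges_cross:
  fixes s t :: real and i j r i' j' r' a :: int
  assumes ij: "(i, j) = (1, 0) \<and> r \<in> {0, 1} \<or> (i, j) = (0, 1) \<and> r = 0"
    and ij': "(i', j') = (1, 0) \<and> r' \<in> {0, 1} \<or> (i', j') = (0, 1) \<and> r' = 0"
    and st: "0 \<le> s" "s \<le> 1" "0 \<le> t" "t \<le> 1"
    and a: "s * i - t * i' = a" and r: "r + s * j = r' + t * j'"
  shows "i = i' \<and> j = j' \<and> r = r' \<and> s = t \<and> a = 0 \<or> s \<in> {0, 1} \<and> t \<in> {0, 1}"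
proof -
  have "\<bar>real_of_int a\<bar> \<le> 1"
    using ij ij' st unfolding a[symmetric] by (auto simp: abs_le_iff)
  then have "a = -1 \<or> a = 0 \<or> a = 1" by linarith
  then consider "a = -1" | "a = 0" | "a = 1" by blast
  then show ?thesis by cases (use ij ij' st a r in auto)
qed

context haar_graph
begin

text \<open>For even \<open>n\<close> the edges with differences \<open>u\<close> and \<open>-u\<close> form two cycles of length \<open>n\<close>, along
  which \<open>R\<close> and \<open>F\<close> alternate, and the remaining edges are the rungs of a prism. The vertex with
  index \<open>k\<close> on the cycle \<open>r \<in> {0, 1}\<close> is drawn at longitude \<open>2 \<pi> k / n\<close> and latitude \<open>r\<close>.\<close>

theorem prism_drawable_on_sphere:
  assumes "coprime u n" "even n"
  shows "drawable_on (vertices, edges {0, u, -u}) (sphere 0 1)"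
proof -
  \<comment> \<open>The parity of \<open>k + r\<close> makes rotations and reflections alternate
    along a cycle and across a rung. It is well defined modulo \<open>n\<close> because
    \<open>n\<close> is even.\<close>
  define W where "W k r = (if even (k + r) then F (k * u) else R (k * u))" for k r :: int
  have cong_u: "[k * u = k' * u] (mod n) \<longleftrightarrow> [k = k'] (mod n)" for k k'
    using assms(1) by (simp add: cong_mult_rcancel)
  have W_eq: "W k r = W k' r' \<longleftrightarrow> [k = k'] (mod n) \<and> r = r'" if "r \<in> {0, 1}" "r' \<in> {0, 1}" for k r k' r'
  proof -
    have "even k \<longleftrightarrow> even k'" if "[k = k'] (mod n)"
      using that assms(2) by (metis cong_dvd_modulus cong_dvd_iff)
    then show ?thesis using that by (auto simp: W_def R_eq_iff F_eq_iff cong_u)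
  qed
  have mult: "\<exists>k. [x = k * u] (mod n)" for x
  proof -
    obtain y where "[u * y = 1] (mod n)" using cong_solve_coprime_int[OF assms(1)] by blast
    then have "[x * (u * y) = x * 1] (mod n)" by (intro cong_mult cong_refl)
    then show ?thesis by (intro exI[of _ "x * y"]) (simp add: cong_sym_eq ac_simps)
  qed
  have "\<exists>k r. r \<in> {0, 1} \<and> v = W k r" if v: "v \<in> vertices" for v
  proof -
    obtain x where x: "v = R x \<or> v = F x" using v by (auto simp: vertices_def)
    obtain k where "[x = k * u] (mod n)" using mult by blast
    then have "v = R (k * u) \<or> v = F (k * u)" using x R_eq_iff F_eq_iff by metis
    then have "v = W k 0 \<or> v = W k 1" unfolding W_def by auto
    then show ?thesis by blast
  qed
  then obtain K r where rep: "\<And>v. v \<in> vertices \<Longrightarrow> r v \<in> {0, 1}" "\<And>v. v \<in> vertices \<Longrightarrow> v = W (K v) (r v)"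
    by metis
  define T where "T x y = sphere_point (x / n) y" for x y :: real
  have T_eq: "T x y = T x' y' \<longleftrightarrow> (\<exists>m. x - x' = real_of_int n * real_of_int m) \<and> y = y'"
    if "0 \<le> y" "y \<le> 1" "0 \<le> y'" "y' \<le> 1" for x y x' y'
  proof -
    have "x / n - x' / n \<in> \<int> \<longleftrightarrow> (\<exists>m. x - x' = real_of_int n * real_of_int m)"
      using n_pos by (auto simp: Ints_def field_simps)
    then show ?thesis unfolding T_def by (subst sphere_point_eq_iff[OF that]) simp
  qed
  have T_int: "T (real_of_int k) (real_of_int r) = T (real_of_int k') (real_of_int r') \<longleftrightarrow> [k = k'] (mod n) \<and> r = r'"
    if "r \<in> {0, 1}" "r' \<in> {0, 1}" for k r k' r'
  proof -
    have "(\<exists>m. real_of_int k - real_of_int k' = real_of_int n * real_of_int m) \<longleftrightarrow> n dvd k - k'"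
      unfolding dvd_def by (metis of_int_diff of_int_eq_iff of_int_mult)
    then show ?thesis using that by (subst T_eq) (auto simp: cong_iff_dvd_diff)
  qed
  define pos where "pos v = T (K v) (r v)" for v
  have posW: "pos (W k j) = T k j" if "j \<in> {0, 1}" for k j
  proof -
    have "W k j \<in> vertices" by (simp add: W_def vertices_def)
    then show ?thesis using rep[of "W k j"] W_eq[of j "r (W k j)" k "K (W k j)"] that
      unfolding pos_def by (subst T_int) (auto simp: cong_sym_eq)
  qed
  have inj: "inj_on pos vertices"
    unfolding inj_on_def pos_def using rep T_int W_eq by metis
  let ?P = "\<lambda>r i j :: int. (i, j) = (1, 0) \<and> r \<in> {0, 1} \<or> (i, j) = (0, 1) \<and> r = 0"
  have "\<exists>k r i j. ?P r i j \<and> e = {W k r, W (k + i) (r + j)}" if e: "e \<in> edges {0, u, -u}" for e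
  proof -
    obtain x s where e: "e = {R x, F (x + s)}" and s: "s \<in> {0, u, -u}" using e by (auto simp: edges_def)
    obtain k where k: "[x = k * u] (mod n)" using mult by blast
    \<comment> \<open>The height at which position \<open>k\<close> carries the rotation; the
      reflection with the same index is at the other height.\<close>
    define r where "r = (if even k then 1 else 0 :: int)"
    have r: "r \<in> {0, 1}" "odd (k + r)" by (auto simp: r_def)
    have R: "R x = W k r" using k r by (simp add: W_def R_eq_iff)
    have F: "F (x + c * u) = F ((k + c) * u)" for c
      unfolding F_eq_iff using cong_add[OF k cong_refl[of "c * u"]] by (simp add: algebra_simps)
    show ?thesis
    proof -
      consider "s = 0" | "s = u" | "s = - u" using s by auto
      then show ?thesis
      proof cases
        case 1
        then have "F (x + s) = W k (1 - r)" using F[of 0] r by (auto simp: W_def)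
        then have "e = {W k 0, W k 1}" using e R r by auto
        then show ?thesis by (intro exI[of _ k] exI[of _ 0] exI[of _ 1]) auto
      next
        case 2
        then have "F (x + s) = W (k + 1) r" using F[of 1] r by (auto simp: W_def)
        then have "e = {W k r, W (k + 1) (r + 0)}" using e R by simp
        then show ?thesis using r by blast
      next
        case 3
        then have "F (x + s) = W (k - 1) r" using F[of "-1"] r by (auto simp: W_def)
        then have "e = {W (k - 1) r, W ((k - 1) + 1) (r + 0)}" using e R by (simp add: insert_commute)
        then show ?thesis using r by blast
      qed
    qed
  qed
  then obtain k q i j where kq: "\<And>e. e \<in> edges {0, u, -u} \<Longrightarrow> ?P (q e) (i e) (j e)"
    "\<And>e. e \<in> edges {0, u, -u} \<Longrightarrow> e = {W (k e) (q e), W (k e + i e) (q e + j e)}"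
    by metis
  define curve where "curve e t = T (k e + t * i e) (q e + t * j e)" for e and t :: real
  have P_range: "q e \<in> {0, 1}" "q e + j e \<in> {0, 1}" if "e \<in> edges {0, u, -u}" for e
    using kq(1)[OF that] by auto
  have P_bounds: "0 \<le> q e + t * j e" "q e + t * j e \<le> 1" if "e \<in> edges {0, u, -u}" "t \<in> {0..1}" for e and t :: real
    using kq(1)[OF that(1)] that(2) by auto
  show ?thesis
  proof (rule drawable_onI[where pos = pos and curve = curve and src = "\<lambda>e. W (k e) (q e)"
        and tgt = "\<lambda>e. W (k e + i e) (q e + j e)"])
    show "vertices \<subseteq> \<Union> (edges {0, u, -u})" by (rule vertices_covered) simp
    show "path (curve e)" for e
      unfolding path_def curve_def T_def using n_pos by (intro continuous_on_sphere_point continuous_intros) auto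
    show "pos ` vertices \<subseteq> sphere 0 1" "path_image (curve e) \<subseteq> sphere 0 1" for e
      using sphere_point_in by (auto simp: pos_def curve_def T_def path_image_def simp del: mem_sphere)
    fix e assume e: "e \<in> edges {0, u, -u}"
    show "curve e 0 = pos (W (k e) (q e))" using P_range[OF e] by (simp add: curve_def posW)
    show "curve e 1 = pos (W (k e + i e) (q e + j e))" using P_range[OF e] by (simp add: curve_def posW)
    obtain x s where "e = {R x, F (x + s)}" using e by (auto simp: edges_def)
    then show "W (k e) (q e) \<noteq> W (k e + i e) (q e + j e)"
      using kq(2)[OF e] by (metis R_neq_F doubleton_eq_iff insert_absorb2)
  next
    fix e f s t
    assume ef: "e \<in> edges {0, u, -u}" "f \<in> edges {0, u, -u}" and st: "s \<in> {0..1}" "t \<in> {0..1}" and eq: "curve e s = curve f t"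
    then obtain m where m: "k e + s * i e - (k f + t * i f) = real_of_int n * real_of_int m" "q e + s * j e = q f + t * j f"
      unfolding curve_def T_eq[OF P_bounds(1)[OF ef(1) st(1)] P_bounds(2)[OF ef(1) st(1)]
          P_bounds(1)[OF ef(2) st(2)] P_bounds(2)[OF ef(2) st(2)]] by blast
    have "s * i e - t * i f = real_of_int (k f - k e + n * m)" using m(1) by simp
    then have "i e = i f \<and> j e = j f \<and> q e = q f \<and> s = t \<and> k f - k e + n * m = 0 \<or> s \<in> {0, 1} \<and> t \<in> {0, 1}"
      using m(2) kq(1)[OF ef(1)] kq(1)[OF ef(2)] st by (intro prism_edges_cross) auto
    then show "e = f \<and> s = t \<or> s \<in> {0, 1} \<and> t \<in> {0, 1}"
    proof (elim disjE conjE)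
      assume same: "i e = i f" "j e = j f" "q e = q f" "s = t" "k f - k e + n * m = 0"
      have "k e = k f + n * m" using same(5) by simp
      then have "[k e = k f] (mod n)" by (simp add: cong_iff_dvd_diff)
      moreover from this have "[k e + i e = k f + i f] (mod n)" using same by (intro cong_add) auto
      ultimately have "W (k e) (q e) = W (k f) (q f)" "W (k e + i e) (q e + j e) = W (k f + i f) (q f + j f)"
        using same P_range ef by (simp_all add: W_eq)
      then have "e = f" using kq(2)[OF ef(1)] kq(2)[OF ef(2)] by metis
      then show ?thesis using same by blast
    qed blast
  qed (use inj kq edges_subset in auto)
qed

end

section \<open>Subdivisions of the complete bipartite graph\<close>

lemma drawable_on_imp_drawing:
  assumes "drawable_on (V, E) S" "\<And>e. e \<in> E \<Longrightarrow> e \<subseteq> V"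
  shows "\<exists>pos curve. drawing V E S pos curve \<and> pos ` V \<subseteq> S"
proof -
  from assms(1) obtain pos curve where *: "inj_on pos V" "pos ` V \<subseteq> S"
    "\<forall>e\<in>E. arc (curve e) \<and> path_image (curve e) \<subseteq> S \<and>
           {pathstart (curve e), pathfinish (curve e)} = pos ` e \<and>
           path_image (curve e) \<inter> pos ` V = pos ` e"
    "\<forall>e\<in>E. \<forall>f\<in>E. e \<noteq> f \<longrightarrow> path_image (curve e) \<inter> path_image (curve f) \<subseteq> pos ` (e \<inter> f)"
    unfolding drawable_on_def fst_conv snd_conv by (elim exE conjE)
  have "drawing V E S pos curve"
    using assms(2) * by (simp add: drawing_def)
  then show ?thesis using *(2) by blast
qed

lemma path_in_append:
  "path_in E (xs @ ys) \<longleftrightarrow> path_in E xs \<and> path_in E ys \<and> set xs \<inter> set ys = {} \<and>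
    (xs = [] \<or> ys = [] \<or> {last xs, hd ys} \<in> E)"
  by (auto simp: path_in_def successively_append_iff)

lemma path_in_rev [simp]: "path_in E (rev xs) \<longleftrightarrow> path_in E xs"
  by (simp add: path_in_def insert_commute)

lemma path_in_map_upto:
  fixes a b :: int
  assumes "inj_on C {a..b}" "\<And>i. a \<le> i \<Longrightarrow> i < b \<Longrightarrow> {C i, C (i + 1)} \<in> E"
  shows "path_in E (map C [a..b])"
proof -
  have "successively (\<lambda>u v. {u, v} \<in> E) (map C [a..b])"
    unfolding successively_conv_nth
  proof (intro allI impI)
    fix i assume "Suc i < length (map C [a..b])"
    then show "{map C [a..b] ! i, map C [a..b] ! Suc i} \<in> E"
      using assms(2)[of "a + int i"] by (simp add: nth_upto ac_simps)
  qed
  then show ?thesis using assms(1) by (simp add: path_in_def distinct_map)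
qed

text \<open>A label \<open>a * p + k * q\<close> is position \<open>a\<close> on the cycle number
  \<open>k\<close>, of \<open>d\<close> cycles with \<open>M\<close> positions each. By
  \<open>wrap\<close>, \<open>d\<close> steps of difference \<open>q\<close> combined with
  \<open>j\<close> backward steps of \<open>p\<close> lead back to cycle \<open>0\<close>, displaced
  by \<open>l\<close>. With \<open>L = 2 * l - 1\<close>, the bounds on \<open>l\<close> say
  \<open>5 \<le> L\<close> and \<open>L + 5 \<le> 2 * M\<close>, which puts the chord ends
  \<open>L\<close>, \<open>L + 2\<close>, \<open>L + 4\<close> after the starts \<open>0\<close>,
  \<open>2\<close>, \<open>4\<close> and within one turn.\<close>

locale haar_chords = haar_graph R F n for R F :: "int \<Rightarrow> 'v" and n +
  fixes p q l M :: int and d j :: nat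
  assumes label_eq_iff: "\<lbrakk>k < d; k' < d\<rbrakk> \<Longrightarrow>
      [a * p + int k * q = a' * p + int k' * q] (mod n) \<longleftrightarrow> [a = a'] (mod M) \<and> k = k'"
    and j_less: "j < d"
    and wrap: "[int d * q - int j * p = l * p] (mod n)"
    and l_bounds: "3 \<le> l" "l \<le> M - 2"
begin

abbreviation E :: "'v set set" where "E \<equiv> edges {0, p, q}"

definition Rv :: "int \<Rightarrow> nat \<Rightarrow> 'v" where "Rv a k = R (a * p + int k * q)"
definition Fv :: "int \<Rightarrow> nat \<Rightarrow> 'v" where "Fv a k = F (a * p + int k * q)"

lemma Rv_eq_iff: "\<lbrakk>k < d; k' < d\<rbrakk> \<Longrightarrow> Rv a k = Rv a' k' \<longleftrightarrow> [a = a'] (mod M) \<and> k = k'"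
  by (simp add: Rv_def R_eq_iff label_eq_iff)

lemma Fv_eq_iff: "\<lbrakk>k < d; k' < d\<rbrakk> \<Longrightarrow> Fv a k = Fv a' k' \<longleftrightarrow> [a = a'] (mod M) \<and> k = k'"
  by (simp add: Fv_def F_eq_iff label_eq_iff)

lemma Rv_neq_Fv [simp]: "Rv a k \<noteq> Fv a' k'" "Fv a' k' \<noteq> Rv a k"
  by (simp_all add: Rv_def Fv_def)

lemma edgesI: "s \<in> D \<Longrightarrow> y = x + s \<Longrightarrow> {R x, F y} \<in> edges D"
  by (auto simp: edges_def)

lemma adjacent:
  "{Rv a k, Fv a k} \<in> E" "{Rv a k, Fv (a + 1) k} \<in> E" "{Rv a k, Fv a (Suc k)} \<in> E"
  unfolding Rv_def Fv_def by (rule edgesI[of 0], simp, simp)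
    (rule edgesI[of p], simp, simp add: algebra_simps, rule edgesI[of q], simp, simp add: algebra_simps)

lemma adjacent_wrap: "{Rv (m - int j) (d - 1), Fv (m + l) 0} \<in> E"
proof -
  have "[m * p + (int d * q - int j * p) = m * p + l * p] (mod n)"
    by (intro cong_add cong_refl wrap)
  \<comment> \<open>Row \<open>d\<close> is not a new cycle: its labels are those of row
    \<open>0\<close> again, shifted.\<close>
  then have "Fv (m + l) 0 = Fv (m - int j) (Suc (d - 1))"
    using j_less unfolding Fv_def F_eq_iff by (simp add: algebra_simps cong_sym_eq)
  then show ?thesis using adjacent(3) by simp
qed

text \<open>The cycle formed by the edges with differences \<open>0\<close> and \<open>p\<close> through \<open>R 0\<close>; its length is
  \<open>2 * M\<close>.\<close>

definition C :: "int \<Rightarrow> 'v" where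
  "C i = (if even i then Rv (i div 2) 0 else Fv ((i + 1) div 2) 0)"

lemma C_adjacent: "{C i, C (i + 1)} \<in> E"
proof (cases "even i")
  case True
  then have "(i + 1 + 1) div 2 = i div 2 + 1" by presburger
  then show ?thesis using True adjacent(2)[of "i div 2" 0] by (simp add: C_def add.commute)
next
  case False
  then show ?thesis using adjacent(1)[of "(i + 1) div 2" 0] by (simp add: C_def insert_commute)
qed

lemma C_eq_iff: "C i = C i' \<longleftrightarrow> [i = i'] (mod (2 * M))"
proof -
  have *: "[x = y] (mod M) \<longleftrightarrow> [2 * x = 2 * y] (mod (2 * M))" for x y
    by (simp only: cong_iff_dvd_diff right_diff_distrib[symmetric] dvd_mult_cancel_left) simp
  have "even i \<longleftrightarrow> even i'" if "[i = i'] (mod (2 * M))"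
    using that by (metis cong_dvd_iff cong_dvd_modulus dvd_triv_left)
  moreover have "C i = C i' \<longleftrightarrow> [i = i'] (mod (2 * M))" if "even i" "even i'"
    using that j_less by (simp add: C_def Rv_eq_iff *)
  moreover have "C i = C i' \<longleftrightarrow> [i = i'] (mod (2 * M))" if "odd i" "odd i'"
  proof -
    have half: "2 * ((i + 1) div 2) = i + 1" "2 * ((i' + 1) div 2) = i' + 1" using that by presburger+
    have "C i = C i' \<longleftrightarrow> Fv ((i + 1) div 2) 0 = Fv ((i' + 1) div 2) 0"
      using that by (simp add: C_def)
    also have "\<dots> \<longleftrightarrow> [(i + 1) div 2 = (i' + 1) div 2] (mod M)"
      using Fv_eq_iff[of 0 0 "(i + 1) div 2" "(i' + 1) div 2"] j_less by blast
    also have "\<dots> \<longleftrightarrow> [i + 1 = i' + 1] (mod (2 * M))" unfolding * half ..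
    finally have "C i = C i' \<longleftrightarrow> [i + 1 = i' + 1] (mod (2 * M))" .
    then show ?thesis by (simp add: cong_iff_dvd_diff)
  qed
  moreover have "C i \<noteq> C i'" if "even i \<noteq> even i'"
    using that by (auto simp: C_def)
  ultimately show ?thesis by blast
qed

lemma inj_on_C: "inj_on C {a..<a + 2 * M}"
proof (rule inj_onI)
  fix x y assume xy: "x \<in> {a..<a + 2 * M}" "y \<in> {a..<a + 2 * M}" "C x = C y"
  then have "2 * M dvd x - y" by (simp add: C_eq_iff cong_iff_dvd_diff)
  moreover have "\<bar>x - y\<bar> < 2 * M" using xy by auto
  ultimately show "x = y" using zdvd_not_zless[of "\<bar>x - y\<bar>" "2 * M"] by fastforce
qed

lemma path_in_C: "b < a + 2 * M \<Longrightarrow> path_in E (map C [a..b])"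
  by (intro path_in_map_upto C_adjacent inj_on_subset[OF inj_on_C[of a]]) auto

text \<open>The interior of a path that leaves the cycle at \<open>C (2 * m)\<close>, crosses each of the other
  \<open>d - 1\<close> parallel cycles along a single edge (of difference \<open>p\<close> the first \<open>j\<close> times), and returns
  to \<open>C (2 * m + 2 * l - 1)\<close>.\<close>

primrec chord_upto :: "int \<Rightarrow> nat \<Rightarrow> 'v list" where
  "chord_upto m 0 = []"
| "chord_upto m (Suc k) = chord_upto m k @
    [Fv (m - int (min k j)) (Suc k), Rv (m - int (min (Suc k) j)) (Suc k)]"

lemma set_chord_upto:
  "v \<in> set (chord_upto m k) \<longleftrightarrow>
    (\<exists>i<k. v = Fv (m - int (min i j)) (Suc i) \<or> v = Rv (m - int (min (Suc i) j)) (Suc i))"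
  by (induction k) (auto simp: less_Suc_eq)

lemma last_chord_upto: "last (Rv m 0 # chord_upto m k) = Rv (m - int (min k j)) k"
  by (cases k) simp_all

lemma path_in_chord_upto: "k < d \<Longrightarrow> path_in E (Rv m 0 # chord_upto m k)"
proof (induction k)
  case 0
  then show ?case by (simp add: path_in_def)
next
  case (Suc k)
  let ?f = "Fv (m - int (min k j)) (Suc k)" and ?r = "Rv (m - int (min (Suc k) j)) (Suc k)"
  have "{?f, ?r} \<in> E"
  proof (cases "k < j")
    case True
    then have "m - int (min k j) = m - int (min (Suc k) j) + 1" by simp
    then show ?thesis by (metis adjacent(2) insert_commute)
  next
    case False
    then have "m - int (min k j) = m - int (min (Suc k) j)" by simp
    then show ?thesis by (metis adjacent(1) insert_commute)
  qed
  then have "path_in E [?f, ?r]" by (simp add: path_in_def)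
  moreover have "{last (Rv m 0 # chord_upto m k), ?f} \<in> E"
    unfolding last_chord_upto by (rule adjacent(3))
  moreover have "set (Rv m 0 # chord_upto m k) \<inter> set [?f, ?r] = {}"
    using Suc.prems by (auto simp: set_chord_upto Rv_eq_iff Fv_eq_iff)
  ultimately show ?case
    using Suc path_in_append[of E "Rv m 0 # chord_upto m k" "[?f, ?r]"] by simp
qed

definition H :: "int \<Rightarrow> 'v list" where "H m = chord_upto m (d - 1)"

lemma C_notin_H [simp]: "C i \<notin> set (H m)"
  using j_less by (auto simp: H_def set_chord_upto C_def Rv_eq_iff Fv_eq_iff)

text \<open>Chords are translates of each other: in every row both have undergone the same
  shift.\<close>

lemma H_disjoint: "set (H m) \<inter> set (H m') = {}" if "\<not> [m = m'] (mod M)"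
proof -
  have *: "\<not> [m - c = m' - c] (mod M)" for c
    using that by (simp add: cong_iff_dvd_diff)
  then show ?thesis using j_less
    by (auto simp: H_def set_chord_upto Rv_eq_iff Fv_eq_iff)
qed

lemma C_even: "C (2 * m) = Rv m 0" by (simp add: C_def)

lemma path_in_H: "path_in E (C (2 * m) # H m)"
  unfolding C_even H_def using j_less by (intro path_in_chord_upto) simp

lemma H_end: "{last (C (2 * m) # H m), C (2 * m + (2 * l - 1))} \<in> E"
proof -
  \<comment> \<open>The last row is \<open>d - 1\<close>, by which all \<open>j\<close> shifts have
    been made. The vertex \<open>Fv (m + l) 0\<close> sits at the odd position
    \<open>2 * (m + l) - 1\<close> of the cycle.\<close>
  have "min (d - 1) j = j" using j_less by simp
  moreover have "(2 * m + (2 * l - 1) + 1) div 2 = m + l" by simp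
  ultimately show ?thesis
    using adjacent_wrap[of m] by (simp add: C_even H_def last_chord_upto C_def del: last.simps)
qed

text \<open>The cycle \<open>C\<close> with the chords from \<open>C 0\<close>, \<open>C 2\<close> and \<open>C 4\<close> is a subdivision of the
  complete bipartite graph with parts \<open>C 0\<close>, \<open>C 4\<close>, \<open>C (L + 2)\<close> and \<open>C 2\<close>, \<open>C L\<close>, \<open>C (L + 4)\<close>.\<close>

theorem not_drawable_on_sphere:
  assumes S: "S homeomorphic sphere (0 :: real^3) 1"
  shows "\<not> drawable_on (vertices, E) S"
proof
  assume "drawable_on (vertices, E) S"
  then obtain pos curve where dr: "drawing vertices E S pos curve" and posS: "pos ` vertices \<subseteq> S"
    using drawable_on_imp_drawing[of vertices E S] edges_subset by blast
  define L where "L = 2 * l - 1"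
  define N where "N = 2 * M"
  have L: "5 \<le> L" "L + 5 \<le> N" using l_bounds by (simp_all add: L_def N_def)
  have CN: "C N = C 0" by (simp add: C_eq_iff N_def cong_iff_dvd_diff)
  have injN: "inj_on C {0..<N}" using inj_on_C[of 0] by (simp add: N_def)
  have inj: "C i = C i' \<longleftrightarrow> i = i'" if "0 \<le> i" "i < N" "0 \<le> i'" "i' < N" for i i'
    using that injN by (auto dest: inj_onD)
  have up: "path_in E (map C [a..b])" if "b < a + N" for a b using that path_in_C by (simp add: N_def)
  have HH: "set (H 0) \<inter> set (H 1) = {}" "set (H 1) \<inter> set (H 2) = {}" "set (H 0) \<inter> set (H 2) = {}"
    using l_bounds by (intro H_disjoint; auto simp: cong_iff_dvd_diff dest: zdvd_imp_le)+
  \<comment> \<open>Three ways from \<open>C 0\<close> to \<open>C 4\<close>: along the cycle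
    through \<open>C 2\<close>; by the first chord to \<open>C L\<close> and back down the cycle;
    backwards around the cycle to \<open>C (L + 4)\<close> and against the third chord. The middle
    chord and two short pieces of the cycle join them to \<open>C (L + 2)\<close>.\<close>
  let ?La = "map C [1..3]" and ?Lb = "H 0 @ rev (map C [5..L])"
    and ?Lc = "rev (H 2 @ map C [L + 4..N - 1])"
  have La: "C 0 # ?La @ [C 4] = map C [0..4]" by (simp add: upto.simps)
  have Lb: "C 0 # ?Lb @ [C 4] = (C 0 # H 0) @ rev (map C [4..L])"
    using L by (simp add: upto_rec1[of 4])
  have Lc: "C 0 # ?Lc @ [C 4] = rev ((C 4 # H 2) @ map C [L + 4..N])"
    using L by (simp add: upto_rec2[of _ N] CN)
  show False
  proof (rule drawing.sphere_no_K33_subdivision[OF dr S posS, where x = "C 0" and y = "C 4" and z = "C (L + 2)"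
        and La = ?La and Lb = ?Lb and Lc = ?Lc and Ma = "(C 2 # H 1) @ [C (L + 2)]"
        and Mb = "map C [L..L + 2]" and Mc = "rev (map C [L + 2..L + 4])"])
    show "path_in E (C 0 # ?La @ [C 4])" unfolding La using L by (intro up) simp
    show "path_in E (C 0 # ?Lb @ [C 4])" unfolding Lb path_in_append
    proof (intro conjI disjI2)
      show "path_in E (C 0 # H 0)" using path_in_H[of 0] by simp
      show "path_in E (rev (map C [4..L]))" using L up by simp
      show "set (C 0 # H 0) \<inter> set (rev (map C [4..L])) = {}"
        using L by (auto simp: inj)
      show "{last (C 0 # H 0), hd (rev (map C [4..L]))} \<in> E"
        using H_end[of 0] L by (simp add: hd_rev last_map L_def upto_rec2 del: last.simps)
    qed
    show "path_in E (C 0 # ?Lc @ [C 4])" unfolding Lc path_in_rev path_in_append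
    proof (intro conjI disjI2)
      show "path_in E (C 4 # H 2)" using path_in_H[of 2] by simp
      show "path_in E (map C [L + 4..N])" using L by (intro up) simp
      have "C ` {L + 4..N} = insert (C 0) (C ` {L + 4..N - 1})"
      proof -
        have "{L + 4..N} = insert N {L + 4..N - 1}" using L by auto
        then show ?thesis using CN by simp
      qed
      then show "set (C 4 # H 2) \<inter> set (map C [L + 4..N]) = {}"
        using L by (auto simp: inj)
      show "{last (C 4 # H 2), hd (map C [L + 4..N])} \<in> E"
        using H_end[of 2] L by (simp add: hd_map L_def upto_rec1 del: last.simps)
    qed
    show "?La \<noteq> []" "?Lb \<noteq> []" "?Lc \<noteq> []" using L by simp_all
    have sets: "set ?La = C ` {1..3}" "set ?Lb = set (H 0) \<union> C ` {5..L}"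
      "set ?Lc = set (H 2) \<union> C ` {L + 4..N - 1}" by auto
    show "set ?La \<inter> set ?Lb = {}" "set ?Lb \<inter> set ?Lc = {}" "set ?La \<inter> set ?Lc = {}"
      unfolding sets using L HH by (auto simp: inj disjoint_iff)
    show "C (L + 2) \<notin> {C 0, C 4} \<union> set ?La \<union> set ?Lb \<union> set ?Lc"
      unfolding sets using L HH by (auto simp: inj disjoint_iff)
    show "path_in E ((C 2 # H 1) @ [C (L + 2)])"
      unfolding path_in_append
    proof (intro conjI disjI2)
      show "path_in E (C 2 # H 1)" using path_in_H[of 1] by simp
      show "path_in E [C (L + 2)]" by (simp add: path_in_def)
      show "set (C 2 # H 1) \<inter> set [C (L + 2)] = {}" using L inj[of "L + 2" 2] by auto
      show "{last (C 2 # H 1), hd [C (L + 2)]} \<in> E"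
        using H_end[of 1] by (simp add: L_def algebra_simps del: last.simps)
    qed
    show "last ((C 2 # H 1) @ [C (L + 2)]) = C (L + 2)" by simp
    show "set ((C 2 # H 1) @ [C (L + 2)]) \<inter> set ?La \<noteq> {}" unfolding sets by auto
    show "set ((C 2 # H 1) @ [C (L + 2)]) \<inter> ({C 0, C 4} \<union> set ?Lb \<union> set ?Lc) = {}"
      unfolding sets using L HH by (auto simp: inj disjoint_iff)
    show "path_in E (map C [L..L + 2])" "path_in E (rev (map C [L + 2..L + 4]))" using L up by auto
    show "last (map C [L..L + 2]) = C (L + 2)" "last (rev (map C [L + 2..L + 4])) = C (L + 2)"
      by (simp_all add: last_map last_rev hd_map upto_rec2[of L] upto_rec1[of "L + 2"])
    have "C L \<in> set (map C [L..L + 2]) \<inter> set ?Lb"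
      "C (L + 4) \<in> set (rev (map C [L + 2..L + 4])) \<inter> set ?Lc"
      unfolding sets using L by auto
    then show "set (map C [L..L + 2]) \<inter> set ?Lb \<noteq> {}" "set (rev (map C [L + 2..L + 4])) \<inter> set ?Lc \<noteq> {}"
      by blast+
    show "set (map C [L..L + 2]) \<inter> ({C 0, C 4} \<union> set ?La \<union> set ?Lc) = {}"
      unfolding sets using L HH by (auto simp: inj disjoint_iff)
    show "set (rev (map C [L + 2..L + 4])) \<inter> ({C 0, C 4} \<union> set ?La \<union> set ?Lb) = {}"
      unfolding sets using L HH by (auto simp: inj disjoint_iff)
  qed
qed

end

section \<open>The reflection group of a triangle\<close>

definition plane_rotation :: "real \<Rightarrow> real^2 \<Rightarrow> real^2" where
  "plane_rotation a x = vector [cos a * x $ 1 - sin a * x $ 2, sin a * x $ 1 + cos a * x $ 2]"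

text \<open>The axis has direction \<open>a / 2\<close>; with the doubled angle as parameter,
  composition is addition or subtraction of parameters.\<close>

definition plane_reflection :: "real \<Rightarrow> real^2 \<Rightarrow> real^2" where
  "plane_reflection a x = vector [cos a * x $ 1 + sin a * x $ 2, sin a * x $ 1 - cos a * x $ 2]"

lemma plane_compose:
  "plane_rotation a \<circ> plane_rotation b = plane_rotation (a + b)"
  "plane_rotation a \<circ> plane_reflection b = plane_reflection (a + b)"
  "plane_reflection a \<circ> plane_rotation b = plane_reflection (a - b)"
  "plane_reflection a \<circ> plane_reflection b = plane_rotation (a - b)"
  by (simp_all add: fun_eq_iff plane_rotation_def plane_reflection_def vec_eq_iff forall_2
      cos_add sin_add cos_diff sin_diff algebra_simps)

lemma plane_rotation_0: "plane_rotation 0 = id"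
  by (simp add: fun_eq_iff plane_rotation_def vec_eq_iff forall_2)

lemma plane_rotation_eq_iff: "plane_rotation a = plane_rotation b \<longleftrightarrow> cos a = cos b \<and> sin a = sin b"
proof
  assume "plane_rotation a = plane_rotation b"
  from fun_cong[OF this, of "vector [1, 0]"] show "cos a = cos b \<and> sin a = sin b"
    by (simp add: plane_rotation_def vec_eq_iff forall_2)
qed (simp add: plane_rotation_def fun_eq_iff)

lemma plane_reflection_eq_iff: "plane_reflection a = plane_reflection b \<longleftrightarrow> cos a = cos b \<and> sin a = sin b"
proof
  assume "plane_reflection a = plane_reflection b"
  from fun_cong[OF this, of "vector [1, 0]"] show "cos a = cos b \<and> sin a = sin b"
    by (simp add: plane_reflection_def vec_eq_iff forall_2)
qed (simp add: plane_reflection_def fun_eq_iff)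

lemma plane_rotation_neq_reflection: "plane_rotation a \<noteq> plane_reflection b"
proof
  assume eq: "plane_rotation a = plane_reflection b"
  from fun_cong[OF eq, of "vector [1, 0]"] fun_cong[OF eq, of "vector [0, 1]"]
  have "cos a = 0" "sin a = 0"
    by (simp_all add: plane_rotation_def plane_reflection_def vec_eq_iff forall_2)
  then show False using sin_cos_squared_add[of a] by simp
qed

lemma polar_form_real2:
  fixes v :: "real^2"
  assumes "v \<noteq> 0"
  obtains r \<theta> where "r > 0" "v = vector [r * cos \<theta>, r * sin \<theta>]"
proof -
  define r \<theta> where "r = cmod (Complex (v $ 1) (v $ 2))" and "\<theta> = Arg (Complex (v $ 1) (v $ 2))"
  have "rcis r \<theta> = Complex (v $ 1) (v $ 2)" by (simp add: r_def \<theta>_def rcis_cmod_Arg)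
  then have r: "r \<ge> 0" "v $ 1 = r * cos \<theta>" "v $ 2 = r * sin \<theta>"
    by (auto simp: complex_eq_iff r_def)
  then have "v = vector [r * cos \<theta>, r * sin \<theta>]" by (simp add: vec_eq_iff forall_2)
  moreover have "r \<noteq> 0" using r assms by (auto simp: vec_eq_iff forall_2)
  ultimately show thesis using that[of r \<theta>] r(1) by simp
qed

lemma line_reflection_polar:
  assumes "r \<noteq> 0"
  shows "line_reflection (vector [r * cos \<theta>, r * sin \<theta>]) = plane_reflection (2 * \<theta>)"
proof
  fix x :: "real^2"
  let ?u = "vector [r * cos \<theta>, r * sin \<theta>] :: real^2"
  have "(r * cos \<theta>)\<^sup>2 + (r * sin \<theta>)\<^sup>2 = r\<^sup>2"
    by (simp add: power_mult_distrib flip: distrib_left)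
  then have uu: "?u \<bullet> ?u = r * r" by (simp add: inner_vec_def sum_2 power2_eq_square)
  have xu: "x \<bullet> ?u = r * (x $ 1 * cos \<theta> + x $ 2 * sin \<theta>)"
    by (simp add: inner_vec_def sum_2 algebra_simps)
  have coef: "2 * (x \<bullet> ?u) / (?u \<bullet> ?u) * (r * c) = 2 * (x $ 1 * cos \<theta> + x $ 2 * sin \<theta>) * c" for c
    unfolding uu xu using assms by (simp add: field_simps)
  have e: "cos \<theta> * cos \<theta> + sin \<theta> * sin \<theta> = 1"
    using sin_cos_squared_add3[of \<theta>] by simp
  have double: "cos (2 * \<theta>) = cos \<theta> * cos \<theta> - sin \<theta> * sin \<theta>" "sin (2 * \<theta>) = 2 * sin \<theta> * cos \<theta>"
    by (simp_all add: cos_double sin_double power2_eq_square)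
  have "2 * (x $ 1 * cos \<theta> + x $ 2 * sin \<theta>) * cos \<theta> - x $ 1 = cos (2 * \<theta>) * x $ 1 + sin (2 * \<theta>) * x $ 2"
    "2 * (x $ 1 * cos \<theta> + x $ 2 * sin \<theta>) * sin \<theta> - x $ 2 = sin (2 * \<theta>) * x $ 1 - cos (2 * \<theta>) * x $ 2"
    unfolding double using e by algebra+
  moreover have "line_reflection ?u x $ 1 = 2 * (x $ 1 * cos \<theta> + x $ 2 * sin \<theta>) * cos \<theta> - x $ 1"
    "line_reflection ?u x $ 2 = 2 * (x $ 1 * cos \<theta> + x $ 2 * sin \<theta>) * sin \<theta> - x $ 2"
    unfolding coef[symmetric] by (simp_all add: line_reflection_def)
  ultimately show "line_reflection ?u x = plane_reflection (2 * \<theta>) x"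
    by (simp only: vec_eq_iff forall_2 plane_reflection_def vector_2)
qed

section \<open>Oriented angles and the directions of the sides\<close>

definition cross2 :: "real^2 \<Rightarrow> real^2 \<Rightarrow> real" where
  "cross2 w v = w $ 1 * v $ 2 - w $ 2 * v $ 1"

text \<open>\<open>arccos\<close> forgets the sense of rotation from \<open>w\<close> to
  \<open>v\<close>; the sign of the cross product restores it as \<open>\<sigma>\<close>.\<close>

lemma polar_form_angle:
  fixes v w :: "real^2"
  assumes "v \<noteq> 0" and r: "r > 0" and w: "w = vector [r * cos \<theta>, r * sin \<theta>]"
    and \<alpha>: "\<alpha> = arccos ((w \<bullet> v) / (norm w * norm v))"
    and \<sigma>: "\<sigma> * cross2 w v \<ge> 0" "\<bar>\<sigma>\<bar> = 1"
  obtains s where "s > 0" "v = vector [s * cos (\<theta> + \<sigma> * \<alpha>), s * sin (\<theta> + \<sigma> * \<alpha>)]"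
proof -
  obtain s \<psi> where s: "s > 0" and v: "v = vector [s * cos \<psi>, s * sin \<psi>]"
    using polar_form_real2[OF assms(1)] by blast
  have norm: "norm (vector [t * cos x, t * sin x] :: real^2) = t" if "t > 0" for t x
  proof -
    have "(t * cos x)\<^sup>2 + (t * sin x)\<^sup>2 = t\<^sup>2" by (simp add: power_mult_distrib flip: distrib_left)
    then show ?thesis using that by (simp add: norm_vec_def L2_set_def sum_2)
  qed
  have "w \<bullet> v = r * s * cos (\<psi> - \<theta>)"
    by (simp add: v w inner_vec_def sum_2 cos_diff algebra_simps)
  then have "(w \<bullet> v) / (norm w * norm v) = cos (\<psi> - \<theta>)"
    using norm[OF r] norm[OF s] r s by (simp add: v w)
  then have \<alpha>: "cos \<alpha> = cos (\<psi> - \<theta>)" "0 \<le> \<alpha>" "\<alpha> \<le> pi"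
    unfolding \<alpha> by (simp_all add: cos_arccos arccos_lbound arccos_ubound)
  have "(sin \<alpha>)\<^sup>2 = (sin (\<psi> - \<theta>))\<^sup>2" using \<alpha>(1) by (simp add: sin_squared_eq)
  then have abs: "\<bar>sin \<alpha>\<bar> = \<bar>sin (\<psi> - \<theta>)\<bar>" by (simp add: power2_eq_iff abs_eq_iff)
  have cr: "cross2 w v = r * s * sin (\<psi> - \<theta>)"
    by (simp add: v w cross2_def sin_diff algebra_simps)
  have "r * s > 0" using r s by simp
  moreover have "\<sigma> * cross2 w v = (r * s) * (\<sigma> * sin (\<psi> - \<theta>))" by (simp add: cr)
  ultimately have "\<sigma> * sin (\<psi> - \<theta>) \<ge> 0" using \<sigma>(1) by (metis zero_le_mult_iff not_less)
  moreover have "sin \<alpha> \<ge> 0" using \<alpha> by (simp add: sin_ge_zero)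
  moreover have "\<sigma> = 1 \<or> \<sigma> = -1" using \<sigma>(2) by auto
  ultimately have sin: "\<sigma> * sin \<alpha> = sin (\<psi> - \<theta>)" using abs by auto
  have sc: "sin (\<sigma> * \<alpha>) = sin (\<psi> - \<theta>)" "cos (\<sigma> * \<alpha>) = cos (\<psi> - \<theta>)"
    using sin \<alpha>(1) \<open>\<sigma> = 1 \<or> \<sigma> = -1\<close> by auto
  have "cos (\<theta> + \<sigma> * \<alpha>) = cos (\<theta> + (\<psi> - \<theta>))" "sin (\<theta> + \<sigma> * \<alpha>) = sin (\<theta> + (\<psi> - \<theta>))"
    unfolding cos_add sin_add sc by simp_all
  then show thesis using that[OF s] v by simp
qed

lemma side_reflections_triangle:
  assumes "triangle_with_angles \<alpha> \<beta> \<gamma> A B C"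
  obtains \<phi> \<sigma> where "\<bar>\<sigma>\<bar> = 1" "side_reflections A B C =
    {plane_reflection \<phi>, plane_reflection (\<phi> + 2 * \<sigma> * \<alpha>), plane_reflection (\<phi> - 2 * \<sigma> * \<beta>)}"
proof -
  have nc: "\<not> collinear {A, B, C}" and ang: "angle_at A B C = \<alpha>" "angle_at B C A = \<beta>"
    using assms by (auto simp: triangle_with_angles_def)
  have ne: "B - A \<noteq> 0" "C - A \<noteq> 0" "C - B \<noteq> 0" "A - B \<noteq> 0" "A - C \<noteq> 0"
    using nc by (auto simp: insert_commute)
  define \<sigma> where "\<sigma> = (if cross2 (B - A) (C - A) \<ge> 0 then 1 else -1 :: real)"
  have \<sigma>: "\<bar>\<sigma>\<bar> = 1" by (simp add: \<sigma>_def)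
  obtain r \<theta> where r: "r > 0" and AB: "B - A = vector [r * cos \<theta>, r * sin \<theta>]"
    using polar_form_real2[OF ne(1)] by blast
  have "\<alpha> = arccos (((B - A) \<bullet> (C - A)) / (norm (B - A) * norm (C - A)))"
    using ang(1) by (simp add: angle_at_def)
  moreover have "\<sigma> * cross2 (B - A) (C - A) \<ge> 0" by (simp add: \<sigma>_def)
  ultimately obtain s where s: "s > 0"
    and AC: "C - A = vector [s * cos (\<theta> + \<sigma> * \<alpha>), s * sin (\<theta> + \<sigma> * \<alpha>)]"
    using polar_form_angle[OF ne(2) r AB] \<sigma> by blast
  have BA: "A - B = vector [r * cos (\<theta> + pi), r * sin (\<theta> + pi)]"
    using AB by (simp add: vec_eq_iff forall_2)
  have "\<beta> = arccos (((A - B) \<bullet> (C - B)) / (norm (A - B) * norm (C - B)))"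
    using ang(2) by (simp add: angle_at_def inner_commute mult.commute)
  moreover have "cross2 (A - B) (C - B) = - cross2 (B - A) (C - A)"
    by (simp add: cross2_def algebra_simps)
  \<comment> \<open>Seen from \<open>B\<close>, the turn from side \<open>AB\<close> to the third
    side has the opposite sense to the one at \<open>A\<close>.\<close>
  then have "(- \<sigma>) * cross2 (A - B) (C - B) \<ge> 0" by (simp add: \<sigma>_def)
  ultimately obtain t where t: "t > 0"
    and BC: "C - B = vector [t * cos (\<theta> + pi + (- \<sigma>) * \<beta>), t * sin (\<theta> + pi + (- \<sigma>) * \<beta>)]"
    using polar_form_angle[OF ne(3) r BA, of \<beta> "- \<sigma>"] \<sigma> by auto
  have CA: "A - C = vector [(- s) * cos (\<theta> + \<sigma> * \<alpha>), (- s) * sin (\<theta> + \<sigma> * \<alpha>)]"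
    using AC by (simp add: vec_eq_iff forall_2)
  have "2 * (\<theta> + pi + (- \<sigma>) * \<beta>) = (2 * \<theta> - 2 * \<sigma> * \<beta>) + 2 * pi" by (simp add: algebra_simps)
  then have per: "plane_reflection (2 * (\<theta> + pi + (- \<sigma>) * \<beta>)) = plane_reflection (2 * \<theta> - 2 * \<sigma> * \<beta>)"
    unfolding plane_reflection_eq_iff by (simp only: cos_periodic sin_periodic)
  have refl: "line_reflection (B - A) = plane_reflection (2 * \<theta>)"
    "line_reflection (A - C) = plane_reflection (2 * (\<theta> + \<sigma> * \<alpha>))"
    "line_reflection (C - B) = plane_reflection (2 * (\<theta> + pi + (- \<sigma>) * \<beta>))"
    unfolding AB BC CA by (rule line_reflection_polar; use r s t in simp)+
  have "side_reflections A B C = {plane_reflection (2 * (\<theta> + pi + (- \<sigma>) * \<beta>)),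
      plane_reflection (2 * (\<theta> + \<sigma> * \<alpha>)), plane_reflection (2 * \<theta>)}"
    unfolding side_reflections_def refl ..
  also have "\<dots> = {plane_reflection (2 * \<theta>), plane_reflection (2 * \<theta> + 2 * \<sigma> * \<alpha>), plane_reflection (2 * \<theta> - 2 * \<sigma> * \<beta>)}"
    unfolding per by (auto simp: algebra_simps)
  finally show thesis using that \<sigma> by blast
qed

section \<open>The group generated by the side reflections\<close>

lemma carrier_BijGroup_UNIV: "f \<in> carrier (BijGroup UNIV) \<longleftrightarrow> bij f"
  by (simp add: BijGroup_def Bij_def)

lemma mult_BijGroup_UNIV: "\<lbrakk>bij f; bij g\<rbrakk> \<Longrightarrow> f \<otimes>\<^bsub>BijGroup UNIV\<^esub> g = f \<circ> g"
  by (simp add: BijGroup_def Bij_def compose_def fun_eq_iff)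

lemma one_BijGroup_UNIV: "\<one>\<^bsub>BijGroup UNIV\<^esub> = id"
  by (simp add: BijGroup_def fun_eq_iff)

lemma bij_plane_rotation: "bij (plane_rotation a)"
  by (rule o_bij[of "plane_rotation (- a)"]) (simp_all add: plane_compose plane_rotation_0)

lemma bij_plane_reflection: "bij (plane_reflection a)"
  by (rule o_bij[of "plane_reflection a"]) (simp_all add: plane_compose plane_rotation_0)

lemma gcd_combination_induct:
  fixes p q n x :: int
  assumes "gcd p (gcd q n) = 1" and "P 0"
    and step: "\<And>x y. y \<in> {p, - p, q, - q, n, - n} \<Longrightarrow> P x \<Longrightarrow> P (x + y)"
  shows "P x"
proof -
  have mult: "P (x + k * y)" if "P x" "y \<in> {p, q, n}" for x y k
  proof (induction k rule: int_induct[of _ 0])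
    case base
    then show ?case using that by simp
  next
    case (step1 i)
    then show ?case using step[of y "x + i * y"] that(2) by (auto simp: algebra_simps)
  next
    case (step2 i)
    then show ?case using step[of "- y" "x + i * y"] that(2) by (auto simp: algebra_simps)
  qed
  obtain a b c where "x = a * p + b * q + c * n" using gcd_3_combination[OF assms(1)] .
  moreover have "P (0 + a * p + b * q + c * n)"
    by (intro mult assms(2)) auto
  ultimately show ?thesis by simp
qed

text \<open>The generators are \<open>F 0\<close>, \<open>F p\<^sub>1\<close> and
  \<open>F (- p\<^sub>2)\<close>. Their pairwise products contain the rotations by
  \<open>p\<^sub>1\<close> and \<open>p\<^sub>2\<close> steps in both senses, which by coprimality
  produce every rotation.\<close>

theorem triangle_graph_is_haar_graph:
  fixes p\<^sub>1 p\<^sub>2 p\<^sub>3 n :: nat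
  assumes "triangle_with_angles (real p\<^sub>1 * pi / real n) (real p\<^sub>2 * pi / real n) \<gamma> A B C"
    and n: "n > 0" and gcd: "gcd (int p\<^sub>1) (gcd (int p\<^sub>2) (int n)) = 1"
  obtains R F where "haar_graph R F (int n)"
    "triangle_graph A B C = (haar_graph.vertices R F, haar_graph.edges R F {0, int p\<^sub>1, - int p\<^sub>2})"
proof -
  obtain \<phi> \<sigma> where \<sigma>: "\<bar>\<sigma>\<bar> = 1" and sides: "side_reflections A B C = {plane_reflection \<phi>,
      plane_reflection (\<phi> + 2 * \<sigma> * (real p\<^sub>1 * pi / real n)), plane_reflection (\<phi> - 2 * \<sigma> * (real p\<^sub>2 * pi / real n))}"
    using side_reflections_triangle[OF assms(1)] by metis
  \<comment> \<open>One step is the \<open>n\<close>-th part of a full turn, taken in the sense of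
    the orientation \<open>\<sigma>\<close> of the triangle, so that the differences have the same
    signs for both orientations.\<close>
  define angle where "angle x = 2 * pi * (\<sigma> * of_int x / n)" for x :: int
  have angle: "angle (x + y) = angle x + angle y" "angle (x - y) = angle x - angle y" "angle 0 = 0" for x y
    by (simp_all add: angle_def algebra_simps add_divide_distrib diff_divide_distrib)
  define R where "R x = plane_rotation (angle x)" for x
  define F where "F x = plane_reflection (\<phi> + angle x)" for x
  have cs: "cos (angle x) = cos (angle y) \<and> sin (angle x) = sin (angle y) \<longleftrightarrow> [x = y] (mod int n)" for x y
  proof -
    have "\<sigma> = 1 \<or> \<sigma> = -1" using \<sigma> by auto
    then have "\<sigma> * of_int x / n - \<sigma> * of_int y / n \<in> \<int> \<longleftrightarrow> (of_int (x - y) / real n) \<in> \<int>"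
    proof
      assume "\<sigma> = -1"
      then have "\<sigma> * of_int x / n - \<sigma> * of_int y / n = - (of_int (x - y) / real n)"
        by (simp add: diff_divide_distrib)
      then show ?thesis by (simp only: minus_in_Ints_iff)
    qed (simp add: diff_divide_distrib)
    also have "\<dots> \<longleftrightarrow> (\<exists>k. real_of_int (x - y) = real_of_int (int n * k))"
      using n by (auto simp: Ints_def field_simps)
    also have "\<dots> \<longleftrightarrow> [x = y] (mod int n)" by (simp only: of_int_eq_iff cong_iff_dvd_diff dvd_def)
    finally show ?thesis unfolding angle_def cos_sin_2pi_eq_iff .
  qed
  have cs': "cos (\<phi> + a) = cos (\<phi> + b) \<and> sin (\<phi> + a) = sin (\<phi> + b) \<longleftrightarrow> cos a = cos b \<and> sin a = sin b" for a b
    using sin_cos_eq_iff[of a b] sin_cos_eq_iff[of "\<phi> + a" "\<phi> + b"] by (auto simp: algebra_simps)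
  have haar: "haar_graph R F (int n)"
    by unfold_locales
      (simp_all add: n R_def F_def plane_rotation_eq_iff plane_reflection_eq_iff plane_rotation_neq_reflection cs cs')
  let ?D = "{0, int p\<^sub>1, - int p\<^sub>2}" and ?G = "BijGroup UNIV :: (real^2 \<Rightarrow> real^2) monoid"
  have sidesF: "side_reflections A B C = F ` ?D"
    unfolding sides F_def by (simp add: angle_def algebra_simps)
  have comp: "R x \<circ> R y = R (x + y)" "R x \<circ> F y = F (x + y)" "F x \<circ> R y = F (x - y)" "F x \<circ> F y = R (x - y)" for x y
    by (simp_all add: R_def F_def plane_compose angle algebra_simps)
  have bij: "bij (R x)" "bij (F x)" for x
    by (simp_all add: R_def F_def bij_plane_rotation bij_plane_reflection)
  have mult: "R x \<otimes>\<^bsub>?G\<^esub> R y = R (x + y)" "R x \<otimes>\<^bsub>?G\<^esub> F y = F (x + y)" "F x \<otimes>\<^bsub>?G\<^esub> R y = F (x - y)" "F x \<otimes>\<^bsub>?G\<^esub> F y = R (x - y)" for x y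
    using bij by (simp_all add: mult_BijGroup_UNIV comp)
  have R0: "R 0 = id" by (simp add: R_def angle plane_rotation_0)
  let ?H = "generate ?G (F ` ?D)"
  have inv: "inv\<^bsub>?G\<^esub> F s = F s" for s
  proof -
    interpret group ?G by (rule group_BijGroup)
    show ?thesis by (rule inv_equality) (use bij in \<open>simp_all add: mult R0 one_BijGroup_UNIV carrier_BijGroup_UNIV\<close>)
  qed
  have carrier: "?H = range R \<union> range F"
  proof
    show "?H \<subseteq> range R \<union> range F"
    proof
      fix f assume "f \<in> ?H"
      then show "f \<in> range R \<union> range F"
      proof (induction rule: generate.induct)
        case one
        then show ?case using R0 by (metis UnI1 one_BijGroup_UNIV rangeI)
      next
        case (incl h)
        then show ?case by blast
      next
        case (inv h)
        then obtain s where "h = F s" by blast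
        then show ?case using \<open>\<And>s. inv\<^bsub>?G\<^esub> F s = F s\<close> by simp
      next
        case (eng f g)
        then show ?case using mult by auto
      qed
    qed
    have F: "F s \<in> ?H" if "s \<in> ?D" for s using that by (intro generate.incl) blast
    have R: "R x \<in> ?H" for x
    proof (rule gcd_combination_induct[OF gcd, where P = "\<lambda>x. R x \<in> ?H"])
      show "R 0 \<in> ?H" unfolding R0 one_BijGroup_UNIV[symmetric] by (rule generate.one)
      fix x y assume y: "y \<in> {int p\<^sub>1, - int p\<^sub>1, int p\<^sub>2, - int p\<^sub>2, int n, - int n}" and x: "R x \<in> ?H"
      have "R (int n) = R 0" "R (- int n) = R 0"
        using haar by (simp_all add: haar_graph.R_eq_iff cong_iff_dvd_diff)
      moreover have "R 0 \<in> ?H" unfolding R0 one_BijGroup_UNIV[symmetric] by (rule generate.one)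
      moreover have "R (s - s') \<in> ?H" if "s \<in> ?D" "s' \<in> ?D" for s s'
        using generate.eng[OF F[OF that(1)] F[OF that(2)]] by (simp add: mult)
      from this[of "int p\<^sub>1" 0] this[of 0 "int p\<^sub>1"] this[of "- int p\<^sub>2" 0] this[of 0 "- int p\<^sub>2"]
      have "R (int p\<^sub>1) \<in> ?H" "R (- int p\<^sub>1) \<in> ?H" "R (- int p\<^sub>2) \<in> ?H" "R (int p\<^sub>2) \<in> ?H" by simp_all
      ultimately have "R y \<in> ?H" using y by auto
      from generate.eng[OF x this] show "R (x + y) \<in> ?H" by (simp add: mult)
    qed
    have "F y \<in> ?H" for y
      using generate.eng[OF R[of y] F[of 0]] by (simp add: mult)
    then show "range R \<union> range F \<subseteq> ?H" using R by blast
  qed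
  have edges: "{{\<sigma>, \<sigma> \<otimes>\<^bsub>?G\<^esub> s} |\<sigma> s. \<sigma> \<in> range R \<union> range F \<and> s \<in> F ` ?D} = {{R x, F (x + s)} |x s. s \<in> ?D}"
    (is "?L = ?R")
  proof
    show "?L \<subseteq> ?R"
    proof
      fix e assume "e \<in> ?L"
      then obtain x s where s: "s \<in> ?D" and "e = {R x, R x \<otimes>\<^bsub>?G\<^esub> F s} \<or> e = {F x, F x \<otimes>\<^bsub>?G\<^esub> F s}" by blast
      \<comment> \<open>Generators are involutions, so the edges leaving reflections are the edges
        leaving rotations read backwards.\<close>
      then have "e = {R x, F (x + s)} \<or> e = {R (x - s), F ((x - s) + s)}" unfolding mult by auto
      then show "e \<in> ?R" using s by blast
    qed
    show "?R \<subseteq> ?L"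
    proof
      fix e assume "e \<in> ?R"
      then obtain x s where s: "s \<in> ?D" and e: "e = {R x, F (x + s)}" by blast
      have "e = {R x, R x \<otimes>\<^bsub>?G\<^esub> F s}" unfolding mult e ..
      then show "e \<in> ?L" using s by blast
    qed
  qed
  have "triangle_graph A B C = (haar_graph.vertices R F, haar_graph.edges R F ?D)"
    unfolding haar_graph.vertices_def[OF haar] haar_graph.edges_def[OF haar]
      triangle_graph_def cayley_graph_def reflection_group_def sidesF
    using carrier edges by simp
  then show thesis using that haar by blast
qed

section \<open>Planarity and the divisors of the order\<close>

lemma dvd_mult_iff_div_gcd:
  fixes n p a :: int
  assumes "n > 0"
  shows "n dvd a * p \<longleftrightarrow> n div gcd p n dvd a"
proof -
  define d where "d = gcd p n"
  have d: "d > 0" using assms by (simp add: d_def)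
  have n: "n = d * (n div d)" and p: "p = d * (p div d)" by (simp_all add: d_def)
  have "coprime (p div d) (n div d)"
    unfolding d_def using assms by (intro div_gcd_coprime) simp
  then have "n div d dvd a * (p div d) \<longleftrightarrow> n div d dvd a"
    by (simp add: coprime_dvd_mult_left_iff coprime_commute)
  moreover have "n dvd a * p \<longleftrightarrow> d * (n div d) dvd d * (a * (p div d))"
    using n p by (metis mult.left_commute)
  moreover have "\<dots> \<longleftrightarrow> n div d dvd a * (p div d)"
    using d by (subst dvd_mult_cancel_left) simp
  ultimately show ?thesis by (simp only: d_def)
qed

context haar_graph
begin

text \<open>The differences \<open>0\<close> and \<open>p\<close> split the vertices into
  \<open>d\<close> cycles of length \<open>2 * M\<close>. As \<open>q\<close> is prime to
  \<open>d\<close>, its multiples up to \<open>d - 1\<close> visit all of them, and \<open>d\<close>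
  steps of \<open>q\<close> return displaced by \<open>l\<close>. Using the edge of difference
  \<open>p\<close> for \<open>j\<close> of the crossings changes the displacement to
  \<open>l - j\<close>.\<close>

lemma step_not_drawable_on_sphere:
  fixes p q l j :: int
  defines "d \<equiv> gcd p n" and "M \<equiv> n div gcd p n"
  assumes S: "S homeomorphic sphere (0 :: real^3) 1" and cop: "coprime d q"
    and l: "[d * q = l * p] (mod n)" and j: "0 \<le> j" "j < d"
    and bounds: "3 \<le> (l - j) mod M" "(l - j) mod M \<le> M - 2"
  shows "\<not> drawable_on (vertices, edges {0, p, q}) S"
proof -
  have d: "d > 0" using n_pos by (simp add: d_def)
  have cong_p: "[a * p = a' * p] (mod n) \<longleftrightarrow> [a = a'] (mod M)" for a a'
    using dvd_mult_iff_div_gcd[OF n_pos, of "a - a'" p]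
    by (simp add: cong_iff_dvd_diff M_def left_diff_distrib)
  interpret haar_chords R F n p q "(l - j) mod M" M "nat d" "nat j"
  proof
    fix k k' :: nat and a a' :: int
    assume k: "k < nat d" "k' < nat d"
    have "k = k'" if "[a * p + int k * q = a' * p + int k' * q] (mod n)"
    proof -
      have "n dvd (a - a') * p + (int k - int k') * q"
        using that by (simp add: cong_iff_dvd_diff algebra_simps)
      then have "d dvd (a - a') * p + (int k - int k') * q"
        unfolding d_def using gcd_dvd2 dvd_trans by blast
      moreover have "d dvd (a - a') * p" by (simp add: d_def)
      ultimately have "d dvd (int k - int k') * q" by (simp add: dvd_add_right_iff)
      then have "d dvd int k - int k'" using cop by (simp add: coprime_dvd_mult_left_iff)
      moreover have "\<bar>int k - int k'\<bar> < d" using k by auto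
      ultimately have "int k - int k' = 0" using dvd_imp_le_int[of "int k - int k'" d] by linarith
      then show ?thesis by simp
    qed
    then show "[a * p + int k * q = a' * p + int k' * q] (mod n) \<longleftrightarrow> [a = a'] (mod M) \<and> k = k'"
      by (auto simp: cong_add_rcancel cong_p)
  next
    show "nat j < nat d" using j by simp
    have "[(l - j) mod M = l - j] (mod M)" by simp
    then have "[(l - j) mod M * p = (l - j) * p] (mod n)" by (simp only: cong_p)
    moreover have "[d * q - j * p = (l - j) * p] (mod n)"
      using cong_diff[OF l cong_refl[of "j * p"]] by (simp add: left_diff_distrib)
    ultimately have "[d * q - j * p = (l - j) mod M * p] (mod n)"
      using cong_sym cong_trans by blast
    then show "[int (nat d) * q - int (nat j) * p = (l - j) mod M * p] (mod n)" using j d by simp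
  qed (use bounds in auto)
  show ?thesis by (rule not_drawable_on_sphere[OF S])
qed

lemma hamiltonian_step_not_drawable_on_sphere:
  assumes S: "S homeomorphic sphere (0 :: real^3) 1" and cop: "coprime p n"
    and ne: "\<not> [q = 0] (mod n)" "\<not> [q = p] (mod n)" "\<not> [q = 2 * p] (mod n)" "\<not> [q = - p] (mod n)"
  shows "\<not> drawable_on (vertices, edges {0, p, q}) S"
proof -
  obtain u where u: "[p * u = 1] (mod n)" using cong_solve_coprime_int[OF cop] by blast
  define l where "l = q * u"
  have "[q * (p * u) = q * 1] (mod n)" by (intro cong_mult u cong_refl)
  then have l: "[q = l * p] (mod n)" by (simp add: l_def ac_simps cong_sym_eq)
  have "[l mod n * p = l * p] (mod n)" by (intro cong_mult) auto
  then have lm: "[q = l mod n * p] (mod n)" using l cong_trans cong_sym by blast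
  \<comment> \<open>The bounds exclude just the residues \<open>0\<close>, \<open>1\<close>,
    \<open>2\<close> and \<open>n - 1\<close> of \<open>l\<close>; multiplied by \<open>p\<close>
    these are the four excluded values of \<open>q\<close>.\<close>
  have "l mod n \<noteq> 0" "l mod n \<noteq> 1" "l mod n \<noteq> 2" using lm ne(1-3) by auto
  moreover have "l mod n \<noteq> n - 1"
  proof
    assume "l mod n = n - 1"
    then have "[q = (n - 1) * p] (mod n)" using lm by simp
    moreover have "[(n - 1) * p = - p] (mod n)" by (simp add: cong_iff_dvd_diff left_diff_distrib)
    ultimately show False using ne(4) cong_trans by blast
  qed
  moreover have "0 \<le> l mod n" "l mod n < n" using n_pos by simp_all
  ultimately have bounds: "3 \<le> l mod n" "l mod n \<le> n - 2" by linarith+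
  have "gcd p n = 1" using cop by (rule coprime_imp_gcd_eq_1)
  then show ?thesis
    using step_not_drawable_on_sphere[OF S, of p q l 0] l bounds by simp
qed

text \<open>With at least five parallel cycles, the freedom in choosing the chords allows their two ends
  to be far apart on the cycle.\<close>

lemma many_cycles_not_drawable_on_sphere:
  fixes p q :: int
  assumes S: "S homeomorphic sphere (0 :: real^3) 1" and cop: "coprime (gcd p n) q"
    and d: "5 \<le> gcd p n" and M: "5 \<le> n div gcd p n"
  shows "\<not> drawable_on (vertices, edges {0, p, q}) S"
proof -
  define M where "M = n div gcd p n"
  obtain t where t: "[p * t = gcd p n] (mod n)" using cong_solve_int by blast
  define l where "l = t * q"
  have "[p * t * q = gcd p n * q] (mod n)" by (intro cong_mult t cong_refl)
  then have l: "[gcd p n * q = l * p] (mod n)" by (simp add: l_def ac_simps cong_sym_eq)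
  define r where "r = l mod M"
  have r: "0 \<le> r" "r < M" using M by (simp_all add: r_def M_def)
  have shift: "(l - j) mod M = (if j \<le> r then r - j else r - j + M)" if "0 \<le> j" "j < 5" for j
  proof -
    have "(l - j) mod M = (r - j) mod M" by (simp add: r_def mod_diff_left_eq)
    also have "\<dots> = (if j \<le> r then r - j else r - j + M)"
    proof (cases "j \<le> r")
      case True
      then show ?thesis using that r by (simp add: mod_pos_pos_trivial)
    next
      case False
      then have "(r - j + M) mod M = r - j + M" using that r M unfolding M_def[symmetric] by (intro mod_pos_pos_trivial) auto
      then show ?thesis using False by simp
    qed
    finally show ?thesis .
  qed
  \<comment> \<open>The bad residues \<open>0\<close>, \<open>1\<close>, \<open>2\<close>,
    \<open>M - 1\<close> are all moved to \<open>M - 2\<close>, by \<open>j = 2, 3, 4, 1\<close>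
    respectively. Thus \<open>j\<close> stays below \<open>5 \<le> gcd p n\<close>, and
    \<open>M \<ge> 5\<close> makes \<open>M - 2\<close> admissible.\<close>
  have "\<exists>j. 0 \<le> j \<and> j < 5 \<and> 3 \<le> (l - j) mod M \<and> (l - j) mod M \<le> M - 2"
  proof -
    consider "3 \<le> r" "r \<le> M - 2" | "r = 0" | "r = 1" | "r = 2" | "r = M - 1" using r by linarith
    then show ?thesis
    proof cases
      case 1 then show ?thesis using shift[of 0] by (intro exI[of _ 0]) simp
    next
      case 2 then show ?thesis using shift[of 2] M by (intro exI[of _ 2]) (simp add: M_def)
    next
      case 3 then show ?thesis using shift[of 3] M by (intro exI[of _ 3]) (simp add: M_def)
    next
      case 4 then show ?thesis using shift[of 4] M by (intro exI[of _ 4]) (simp add: M_def)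
    next
      case 5 then show ?thesis using shift[of 1] M by (intro exI[of _ 1]) (simp add: M_def)
    qed
  qed
  then obtain j where "0 \<le> j" "j < 5" "3 \<le> (l - j) mod M" "(l - j) mod M \<le> M - 2" by blast
  then show ?thesis using step_not_drawable_on_sphere[OF S cop l, of j] d by (simp add: M_def)
qed

lemma K33_not_drawable_on_sphere:
  assumes S: "S homeomorphic sphere (0 :: real^3) 1" and n: "n = 3"
  shows "\<not> drawable_on (vertices, edges {0, 1, -1}) S"
proof
  assume "drawable_on (vertices, edges {0, 1, -1}) S"
  then obtain pos curve where dr: "drawing vertices (edges {0, 1, -1}) S pos curve" and posS: "pos ` vertices \<subseteq> S"
    using drawable_on_imp_drawing[of vertices "edges {0, 1, -1}" S] edges_subset by blast
  have edge: "{R x, F y} \<in> edges {0, 1, -1}" for x y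
  proof -
    have "[y = x + 0] (mod 3) \<or> [y = x + 1] (mod 3) \<or> [y = x + - 1] (mod 3)"
      unfolding cong_iff_dvd_diff by presburger
    then obtain s where s: "s \<in> {0, 1, -1}" and "F y = F (x + s)" unfolding F_eq_iff n by blast
    then have "{R x, F y} = {R x, F (x + s)}" by simp
    then show ?thesis using s unfolding edges_def by blast
  qed
  have edge': "{F y, R x} \<in> edges {0, 1, -1}" for x y using edge[of x y] by (simp add: insert_commute)
  have distinct: "R 0 \<noteq> R 1" "R 1 \<noteq> R 2" "R 0 \<noteq> R 2" "F 0 \<noteq> F 1" "F 1 \<noteq> F 2" "F 0 \<noteq> F 2"
    by (simp_all add: R_eq_iff F_eq_iff n cong_def)
  show False
    by (rule drawing.sphere_no_K33_subdivision[OF dr S posS, where x = "R 0" and y = "R 1" and z = "R 2"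
          and La = "[F 0]" and Lb = "[F 1]" and Lc = "[F 2]"
          and Ma = "[F 0, R 2]" and Mb = "[F 1, R 2]" and Mc = "[F 2, R 2]"])
      (use distinct distinct[symmetric] edge edge' in \<open>auto simp: path_in_def\<close>)
qed

end

section \<open>Cyclic symmetry and arithmetic of the angle numbers\<close>

lemma triangle_with_angles_rotate:
  "triangle_with_angles a b c A B C \<Longrightarrow> triangle_with_angles b c a B C A"
  by (simp add: triangle_with_angles_def insert_commute)

lemma triangle_graph_rotate: "triangle_graph B C A = triangle_graph A B C"
proof -
  have "side_reflections B C A = side_reflections A B C" by (auto simp: side_reflections_def)
  then show ?thesis by (simp add: triangle_graph_def reflection_group_def)
qed

locale rational_triangle =
  fixes p\<^sub>1 p\<^sub>2 p\<^sub>3 n :: nat and A B C :: "real^2"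
  assumes pos: "p\<^sub>1 > 0" "p\<^sub>2 > 0" "p\<^sub>3 > 0"
    and gcd: "Gcd {p\<^sub>1, p\<^sub>2, p\<^sub>3} = 1"
    and n: "n = p\<^sub>1 + p\<^sub>2 + p\<^sub>3"
    and angles: "triangle_with_angles (real p\<^sub>1 * pi / real n) (real p\<^sub>2 * pi / real n)
           (real p\<^sub>3 * pi / real n) A B C"
begin

lemma rotate: "rational_triangle p\<^sub>2 p\<^sub>3 p\<^sub>1 n B C A"
  using pos gcd n triangle_with_angles_rotate[OF angles]
  by unfold_locales (simp_all add: insert_commute ac_simps)

lemma common_divisor: "\<lbrakk>m dvd p\<^sub>1; m dvd p\<^sub>2; m dvd n\<rbrakk> \<Longrightarrow> m = 1"
proof -
  assume m: "m dvd p\<^sub>1" "m dvd p\<^sub>2" "m dvd n"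
  then have "m dvd p\<^sub>3" using n by (metis dvd_add_right_iff dvd_add)
  then have "m dvd Gcd {p\<^sub>1, p\<^sub>2, p\<^sub>3}" using m by (intro Gcd_greatest) auto
  then show "m = 1" by (simp only: gcd nat_dvd_1_iff_1)
qed

lemma coprime_gcd: "coprime (gcd p\<^sub>1 n) p\<^sub>2"
proof (rule coprimeI)
  fix c assume "c dvd gcd p\<^sub>1 n" "c dvd p\<^sub>2"
  then show "is_unit c" using common_divisor[of c] by simp
qed

lemma coprime_gcds: "coprime (gcd p\<^sub>1 n) (gcd p\<^sub>2 n)"
  using coprime_gcd by (rule coprime_divisors[rotated 2]) simp_all

text \<open>For odd \<open>n\<close> this makes the number at the apex a candidate for
  \<open>planar_coprime\<close>, which then leaves only the equilateral triangle.\<close>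

lemma isosceles_odd_coprime:
  assumes "p\<^sub>1 = p\<^sub>2" "odd n"
  shows "coprime p\<^sub>3 n"
proof (rule coprimeI)
  fix c assume c: "c dvd p\<^sub>3" "c dvd n"
  then have "c dvd 2 * p\<^sub>1" using n assms(1) by (metis dvd_add_left_iff mult_2)
  moreover have "coprime c 2" using c(2) assms(2) by (metis coprime_commute coprime_left_2_iff_odd dvd_trans)
  ultimately have "c dvd p\<^sub>1" by (simp add: coprime_dvd_mult_right_iff)
  then show "is_unit c" using common_divisor[of c] c assms(1) by simp
qed

lemma gcd_int: "gcd (int p\<^sub>1) (gcd (int p\<^sub>2) (int n)) = 1"
proof -
  have "gcd p\<^sub>1 (gcd p\<^sub>2 n) = 1"
    by (rule common_divisor) (meson dvd_trans gcd_dvd1 gcd_dvd2)+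
  then show ?thesis by (metis gcd_int_int_eq of_nat_1)
qed

lemma haar_graphE:
  obtains R F where "haar_graph R F (int n)"
    "triangle_graph A B C = (haar_graph.vertices R F, haar_graph.edges R F {0, int p\<^sub>1, - int p\<^sub>2})"
  using triangle_graph_is_haar_graph[OF angles _ gcd_int] pos n by auto

lemma drawable_on_torus: "drawable_on (triangle_graph A B C) torus"
proof -
  obtain R F where haar: "haar_graph R F (int n)"
    and graph: "triangle_graph A B C = (haar_graph.vertices R F, haar_graph.edges R F {0, int p\<^sub>1, - int p\<^sub>2})"
    by (rule haar_graphE)
  interpret haar_graph R F "int n" by (rule haar)
  show ?thesis unfolding graph by (rule drawable_on_torus) (use gcd_int in simp)
qed

lemma isosceles_drawable_on_sphere:
  assumes "p\<^sub>1 = p\<^sub>2" "even n"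
  shows "drawable_on (triangle_graph A B C) (sphere 0 1)"
proof -
  obtain R F where haar: "haar_graph R F (int n)"
    and graph: "triangle_graph A B C = (haar_graph.vertices R F, haar_graph.edges R F {0, int p\<^sub>1, - int p\<^sub>2})"
    by (rule haar_graphE)
  interpret haar_graph R F "int n" by (rule haar)
  have "coprime (int p\<^sub>1) (int n)" using gcd_int assms(1) by (simp add: coprime_iff_gcd_eq_1)
  then show ?thesis unfolding graph assms(1)[symmetric]
    using assms(2) by (intro prism_drawable_on_sphere) simp_all
qed

lemma small_cong: "[int a = int b] (mod int n) \<longleftrightarrow> a = b" if "a < n" "b < n"
  using that by (simp add: cong_int_iff cong_def)

lemma
  assumes S: "S homeomorphic sphere (0 :: real^3) 1" and drawable: "drawable_on (triangle_graph A B C) S"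
  shows planar_coprime: "coprime p\<^sub>1 n \<Longrightarrow> p\<^sub>1 = p\<^sub>2 \<or> p\<^sub>1 = p\<^sub>3"
    and planar_gcd: "\<not> (5 \<le> gcd p\<^sub>1 n \<and> 1 < gcd p\<^sub>2 n \<and> 1 < gcd p\<^sub>3 n)"
    and planar_not_equilateral: "\<not> (p\<^sub>1 = p\<^sub>2 \<and> p\<^sub>2 = p\<^sub>3)"
proof -
  obtain R F where haar: "haar_graph R F (int n)"
    and graph: "triangle_graph A B C = (haar_graph.vertices R F, haar_graph.edges R F {0, int p\<^sub>1, - int p\<^sub>2})"
    by (rule haar_graphE)
  interpret haar_graph R F "int n" by (rule haar)
  note drawable = drawable[unfolded graph]
  have zero: "a = b" if "int n dvd int a - int b" "a < n" "b < n" for a b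
    using that small_cong[of a b] by (simp add: cong_iff_dvd_diff)
  show "p\<^sub>1 = p\<^sub>2 \<or> p\<^sub>1 = p\<^sub>3" if "coprime p\<^sub>1 n"
  proof (rule ccontr)
    assume ne: "\<not> (p\<^sub>1 = p\<^sub>2 \<or> p\<^sub>1 = p\<^sub>3)"
    have "\<not> drawable_on (vertices, edges {0, int p\<^sub>1, - int p\<^sub>2}) S"
    proof (rule hamiltonian_step_not_drawable_on_sphere[OF S])
      show "coprime (int p\<^sub>1) (int n)" using that by simp
      show "\<not> [- int p\<^sub>2 = 0] (mod int n)"
        using pos n by (auto simp: cong_iff_dvd_diff dest: zdvd_imp_le)
      show "\<not> [- int p\<^sub>2 = int p\<^sub>1] (mod int n)"
      proof
        assume "[- int p\<^sub>2 = int p\<^sub>1] (mod int n)"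
        then have "int n dvd - int p\<^sub>2 - int p\<^sub>1" by (simp only: cong_iff_dvd_diff)
        moreover have "- int p\<^sub>2 - int p\<^sub>1 = - (int p\<^sub>1 + int p\<^sub>2)" by simp
        ultimately have "int n dvd int p\<^sub>1 + int p\<^sub>2" by (simp only: dvd_minus_iff)
        then show False using pos n by (auto dest: zdvd_imp_le)
      qed
      show "\<not> [- int p\<^sub>2 = 2 * int p\<^sub>1] (mod int n)"
      proof
        assume "[- int p\<^sub>2 = 2 * int p\<^sub>1] (mod int n)"
        then have "int n dvd - int p\<^sub>2 - 2 * int p\<^sub>1 + int n" by (simp add: cong_iff_dvd_diff)
        \<comment> \<open>Adding \<open>n\<close> brings in the third angle: the exclusion of
          \<open>2 * p\<^sub>1\<close> is the condition
          \<open>p\<^sub>1 \<noteq> p\<^sub>3\<close>.\<close>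
        moreover have "- int p\<^sub>2 - 2 * int p\<^sub>1 + int n = int p\<^sub>3 - int p\<^sub>1" using n by simp
        ultimately show False using zero[of p\<^sub>3 p\<^sub>1] ne pos n by auto
      qed
      show "\<not> [- int p\<^sub>2 = - int p\<^sub>1] (mod int n)"
        using zero[of p\<^sub>1 p\<^sub>2] ne pos n by (auto simp: cong_iff_dvd_diff)
    qed
    then show False using drawable by simp
  qed
  show "\<not> (5 \<le> gcd p\<^sub>1 n \<and> 1 < gcd p\<^sub>2 n \<and> 1 < gcd p\<^sub>3 n)"
  proof
    assume *: "5 \<le> gcd p\<^sub>1 n \<and> 1 < gcd p\<^sub>2 n \<and> 1 < gcd p\<^sub>3 n"
    interpret r: rational_triangle p\<^sub>2 p\<^sub>3 p\<^sub>1 n B C A by (rule rotate)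
    interpret r': rational_triangle p\<^sub>3 p\<^sub>1 p\<^sub>2 n C A B by (rule r.rotate)
    note cop = coprime_gcds r.coprime_gcds r'.coprime_gcds
    \<comment> \<open>The cycle length comes from the other two divisors: being coprime and above
      \<open>1\<close> they have a product of at least \<open>5\<close>, and this product divides
      \<open>n div gcd p\<^sub>1 n\<close>.\<close>
    have "gcd p\<^sub>2 n \<noteq> gcd p\<^sub>3 n" using cop(2) * by auto
    moreover have "2 * 2 \<le> gcd p\<^sub>2 n * gcd p\<^sub>3 n" using * by (intro mult_mono) auto
    moreover have "gcd p\<^sub>2 n * gcd p\<^sub>3 n \<noteq> 4"
    proof
      assume "gcd p\<^sub>2 n * gcd p\<^sub>3 n = 4"
      moreover have "2 * gcd p\<^sub>3 n \<le> gcd p\<^sub>2 n * gcd p\<^sub>3 n" using * by (intro mult_right_mono) auto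
      ultimately have "gcd p\<^sub>3 n = 2" using * by auto
      then show False using \<open>gcd p\<^sub>2 n * gcd p\<^sub>3 n = 4\<close> \<open>gcd p\<^sub>2 n \<noteq> gcd p\<^sub>3 n\<close> by simp
    qed
    ultimately have "5 \<le> gcd p\<^sub>2 n * gcd p\<^sub>3 n" by linarith
    moreover have "gcd p\<^sub>1 n * (gcd p\<^sub>2 n * gcd p\<^sub>3 n) dvd n"
      using cop by (intro divides_mult) (auto simp: coprime_commute)
    then have "gcd p\<^sub>2 n * gcd p\<^sub>3 n dvd n div gcd p\<^sub>1 n"
      using pos by (simp add: dvd_div_iff_mult ac_simps)
    then have "gcd p\<^sub>2 n * gcd p\<^sub>3 n \<le> n div gcd p\<^sub>1 n"
      using pos n by (intro dvd_imp_le) (auto simp: div_greater_zero_iff intro: gcd_le2_nat)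
    ultimately have "5 \<le> n div gcd p\<^sub>1 n" by linarith
    then have M: "5 \<le> int n div gcd (int p\<^sub>1) (int n)" by (simp flip: of_nat_div)
    have d: "5 \<le> gcd (int p\<^sub>1) (int n)" using * by simp
    have "coprime (gcd (int p\<^sub>1) (int n)) (- int p\<^sub>2)" using coprime_gcd by simp
    from many_cycles_not_drawable_on_sphere[OF S this d M] show False using drawable by simp
  qed
  show "\<not> (p\<^sub>1 = p\<^sub>2 \<and> p\<^sub>2 = p\<^sub>3)"
  proof
    assume eq: "p\<^sub>1 = p\<^sub>2 \<and> p\<^sub>2 = p\<^sub>3"
    then have 1: "p\<^sub>1 = 1" "p\<^sub>2 = 1" using gcd by simp_all
    then have "int n = 3" using eq n by simp
    then show False using K33_not_drawable_on_sphere[OF S] drawable by (simp add: 1)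
  qed
qed

end

theorem theorem6:
  fixes p\<^sub>1 p\<^sub>2 p\<^sub>3 n :: nat and A B C :: "real^2"
  assumes "p\<^sub>1 > 0" and "p\<^sub>2 > 0" and "p\<^sub>3 > 0"
    and "Gcd {p\<^sub>1, p\<^sub>2, p\<^sub>3} = 1"
    and "n = p\<^sub>1 + p\<^sub>2 + p\<^sub>3"
    and "triangle_with_angles (real p\<^sub>1 * pi / real n) (real p\<^sub>2 * pi / real n)
           (real p\<^sub>3 * pi / real n) A B C"
  shows "graph_genus (triangle_graph A B C) \<in> {0, 1} \<and>
    (graph_genus (triangle_graph A B C) = 0 \<longleftrightarrow> isosceles A B C \<and> even n)"
proof -
  interpret t1: rational_triangle p\<^sub>1 p\<^sub>2 p\<^sub>3 n A B C using assms by unfold_locales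
  interpret t2: rational_triangle p\<^sub>2 p\<^sub>3 p\<^sub>1 n B C A by (rule t1.rotate)
  interpret t3: rational_triangle p\<^sub>3 p\<^sub>1 p\<^sub>2 n C A B by (rule t2.rotate)
  have graphs: "triangle_graph B C A = triangle_graph A B C" "triangle_graph C A B = triangle_graph A B C"
    using triangle_graph_rotate by metis+
  let ?P = "\<lambda>g. \<exists>S. closed_orientable_surface g S \<and> drawable_on (triangle_graph A B C) S"
  have P1: "?P 1" using closed_orientable_surface_torus t1.drawable_on_torus by blast
  then have le: "graph_genus (triangle_graph A B C) \<le> 1" unfolding graph_genus_def by (rule Least_le)
  have zero: "graph_genus (triangle_graph A B C) = 0 \<longleftrightarrow> ?P 0"
  proof
    assume "graph_genus (triangle_graph A B C) = 0"
    then show "?P 0" using LeastI[of ?P 1, OF P1] unfolding graph_genus_def by simp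
  next
    assume "?P 0"
    then have "graph_genus (triangle_graph A B C) \<le> 0" unfolding graph_genus_def by (rule Least_le)
    then show "graph_genus (triangle_graph A B C) = 0" by simp
  qed
  have iso: "isosceles A B C \<longleftrightarrow> p\<^sub>1 = p\<^sub>2 \<or> p\<^sub>2 = p\<^sub>3 \<or> p\<^sub>3 = p\<^sub>1"
    using assms(1-3,5) assms(6) unfolding isosceles_def triangle_with_angles_def by auto
  have "?P 0 \<longleftrightarrow> (p\<^sub>1 = p\<^sub>2 \<or> p\<^sub>2 = p\<^sub>3 \<or> p\<^sub>3 = p\<^sub>1) \<and> even n"
  proof
    assume "(p\<^sub>1 = p\<^sub>2 \<or> p\<^sub>2 = p\<^sub>3 \<or> p\<^sub>3 = p\<^sub>1) \<and> even n"
    then have "drawable_on (triangle_graph A B C) (sphere 0 1)"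
      using t1.isosceles_drawable_on_sphere t2.isosceles_drawable_on_sphere t3.isosceles_drawable_on_sphere
      unfolding graphs by blast
    moreover have "closed_orientable_surface 0 (sphere 0 1)" by (simp add: closed_orientable_surface_def homeomorphic_refl)
    ultimately show "?P 0" by blast
  next
    assume "?P 0"
    then obtain S where S: "S homeomorphic sphere (0 :: real^3) 1" and drawable: "drawable_on (triangle_graph A B C) S"
      by (auto simp: closed_orientable_surface_def)
    note cop = t1.planar_coprime[OF S drawable] t2.planar_coprime[OF S drawable[folded graphs(1)]]
      t3.planar_coprime[OF S drawable[folded graphs(2)]]
    note many = t1.planar_gcd[OF S drawable] t2.planar_gcd[OF S drawable[folded graphs(1)]]
      t3.planar_gcd[OF S drawable[folded graphs(2)]]
    have ne: "\<not> (p\<^sub>1 = p\<^sub>2 \<and> p\<^sub>2 = p\<^sub>3)" by (rule t1.planar_not_equilateral[OF S drawable])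
    have "coprime p\<^sub>1 n \<or> coprime p\<^sub>2 n \<or> coprime p\<^sub>3 n"
    proof (rule ccontr)
      assume not_coprime: "\<not> ?thesis"
      have "gcd x n > 1" if "\<not> coprime x n" for x
      proof -
        have "gcd x n \<noteq> 0" using assms(1,5) by simp
        moreover have "gcd x n \<noteq> 1" using that by (simp add: coprime_iff_gcd_eq_1)
        ultimately show ?thesis by linarith
      qed
      then have gt: "gcd p\<^sub>1 n > 1" "gcd p\<^sub>2 n > 1" "gcd p\<^sub>3 n > 1" using not_coprime by blast+
      then have "gcd p\<^sub>1 n < 5" "gcd p\<^sub>2 n < 5" "gcd p\<^sub>3 n < 5" using many by linarith+
      \<comment> \<open>Three pairwise coprime numbers cannot all come from \<open>2\<close>,
        \<open>3\<close>, \<open>4\<close>: two of them would be even or both equal to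
        \<open>3\<close>.\<close>
      moreover have "even d \<or> d = 3" if "1 < d" "d < 5" for d :: nat
        using that by presburger
      ultimately have "even (gcd p\<^sub>1 n) \<or> gcd p\<^sub>1 n = 3" "even (gcd p\<^sub>2 n) \<or> gcd p\<^sub>2 n = 3"
        "even (gcd p\<^sub>3 n) \<or> gcd p\<^sub>3 n = 3" using gt by blast+
      moreover have "\<not> (even a \<and> even b)" "\<not> (a = 3 \<and> b = 3)" if "coprime a b" for a b :: nat
        using that by (auto dest: coprime_common_divisor_nat)
      ultimately show False using t1.coprime_gcds t2.coprime_gcds t3.coprime_gcds by metis
    qed
    then have eq: "p\<^sub>1 = p\<^sub>2 \<or> p\<^sub>2 = p\<^sub>3 \<or> p\<^sub>3 = p\<^sub>1" using cop by blast
    moreover have "even n"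
      \<comment> \<open>If \<open>n\<close> were odd, the number differing from the two equal ones
        would be coprime to \<open>n\<close> and hence equal to one of them, making the triangle
        equilateral.\<close>
      using eq cop ne t1.isosceles_odd_coprime t2.isosceles_odd_coprime t3.isosceles_odd_coprime by metis
    ultimately show "(p\<^sub>1 = p\<^sub>2 \<or> p\<^sub>2 = p\<^sub>3 \<or> p\<^sub>3 = p\<^sub>1) \<and> even n" by blast
  qed
  then show ?thesis using le zero iso by auto
qed

end
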